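(* Let $\{\pi_k\}_{k\ge0}$ and $\{V^{\pi_k}\}_{k\ge0}$ be the sequences of policies and value functions generated by PMD with mirror map $h(p)=\sum_a\psi(p(a))$ and a constant step size $\eta>0$. If $\psi'(0^+)=-\infty$ and $\psi'(1^-)=+\infty$, then for any $\sigma\in(0,\Delta/2)$ there are finite constants $C_1(\sigma)$, $C_2(\sigma)$ such that $$\forall\,k\ge T(\sigma):\quad\|V^*-V^{\pi_k}\|_\infty\le\frac{|\mathcal A|}{(1-\gamma)^2}\left\{\varphi^{-1}\Big(\tfrac12\big(k\eta(\Delta-2\sigma)+C_1(\sigma)\big)\Big)+\chi^{-1}\Big(\tfrac12\big(k\eta(\Delta-2\sigma)+C_1(\sigma)\big)\Big)\right\},$$ $$\forall\,k\ge T(\sigma):\quad\|V^*-V^{\pi_k}\|_\infty\ge\Delta\,\varphi^{-1}\big(k\eta(\Delta+2\sigma)+C_2(\sigma)\big),$$ where $\varphi(x):=-\psi'(x)$ and $\chi(x):=\psi'(1-x)$.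
   Context: MDP: $(\mathcal S,\mathcal A,P,r,\gamma)$ is a finite discounted Markov decision process: finite state space $\mathcal S$, finite action space $\mathcal A$, transition model $P(\cdot|s,a)\in\Delta(\mathcal S)$, reward $r:\mathcal S\times\mathcal A\to[0,1]$, discount $\gamma\in[0,1)$. $\Delta(\mathcal X)$ is the probability simplex over a finite set $\mathcal X$. A policy $\pi$ assigns to each $s$ a distribution $\pi(\cdot|s)\in\Delta(\mathcal A)$; $\Pi$ is the set of all policies. $V^\pi(s)$ is the expected value of $\sum_{t\ge0}\gamma^t r(s_t,a_t)$ given $s_0=s$, $a_t\sim\pi(\cdot|s_t)$, $s_{t+1}\sim P(\cdot|s_t,a_t)$, and $Q^\pi(s,a)$ is the same conditioned on $(s_0,a_0)=(s,a)$. $V^*(s)=\max_{\pi\in\Pi}V^\pi(s)$, $Q^*(s,a)=\max_{\pi\in\Pi}Q^\pi(s,a)$. $\mathcal A^*_s=\{a: Q^*(s,a)=V^*(s)\}$, $\tilde{\mathcal S}=\{s:\mathcal A_s^*\ne\mathcal A\}$, assumed nonempty throughout. For $s\in\tilde{\mathcal S}$, $\Delta_s=V^*(s)-\max_{a'\notin\mathcal A_s^*}Q^*(s,a')$, and $\Delta=\min_{s\in\tilde{\mathcal S}}\Delta_s>0$ (a number; not to be confused with the simplex $\Delta(\cdot)$). Mirror map: $\psi:\mathbb R\to(-\infty,+\infty]$ satisfies: (a) $\mathrm{dom}\,\psi\supseteq[0,1]$; (b) $\psi$ is proper, closed and convex; (c) $\psi$ is differentiable on $\mathrm{int}\,\mathrm{dom}\,\psi$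 and $|\psi'(x_n)|\to\infty$ for every sequence $\{x_n\}\subseteq\mathrm{int}\,\mathrm{dom}\,\psi$ converging to a boundary point of $\mathrm{dom}\,\psi$; (d) $\psi$ is strictly convex on $\mathrm{int}\,\mathrm{dom}\,\psi$. $\psi'(0^+)$ and $\psi'(1^-)$ are the one-sided limits of $\psi'$ at $0$ from the right and at $1$ from the left. $h(p)=\sum_{a\in\mathcal A}\psi(p(a))$ and $D_h(p\|q)=h(p)-h(q)-\langle\nabla h(q),p-q\rangle$. When $\psi'(0^+)=-\infty$ and $\psi'(1^-)=+\infty$, $\mathrm{dom}\,\psi=[0,1]$ and $\varphi,\chi$ are continuous strictly decreasing maps of $(0,1)$ onto $\mathbb R$, with inverses $\varphi^{-1},\chi^{-1}:\mathbb R\to(0,1)$. PMD: given $\eta>0$ and an initial policy $\pi_0$ with $\pi_0(a|s)\in\mathrm{int}\,\mathrm{dom}\,\psi$ for all $(s,a)$ (assumed throughout), for each $s$, $\pi_{k+1}(\cdot|s)=\arg\max_{p\in\Delta(\mathcal A)}\{\eta\langle p,Q^{\pi_k}(s,\cdot)\rangle-D_h(p\|\pi_k(\cdot|s))\}$; all iterates satisfy $\pi_k(a|s)\in\mathrm{int}\,\mathrm{dom}\,\psi$. For $\sigma>0$, $T(\sigma):=\min\{k:\ \|V^*-V^{\pi_k}\|_\infty\le\sigma\}$, which is finite. *)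

theory Defs
  imports "HOL-Probability.Probability"
begin

text \<open>
  Law of a time-homogeneous Markov chain with initial distribution \<open>\<mu>\<close> and transition kernel
  \<open>K\<close>, as a measure on infinite trajectories (Ionescu-Tulcea extension). At time \<open>i\<close> the
  kernel only sees the restriction of the trajectory to \<open>{0..<i}\<close>.
\<close>

definition chain_step :: "'x pmf \<Rightarrow> ('x \<Rightarrow> 'x pmf) \<Rightarrow> nat \<Rightarrow> (nat \<Rightarrow> 'x) \<Rightarrow> 'x measure" where
  "chain_step \<mu> K i \<omega> = measure_pmf (if i = 0 then \<mu> else K (\<omega> (i - 1)))"

interpretation chain: Ionescu_Tulcea "chain_step \<mu> K" "\<lambda>_. count_space UNIV"
  for \<mu> :: "'x pmf" and K
proof (rule Ionescu_Tulcea.intro)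
  show "chain_step \<mu> K i \<in> measurable (PiM {0..<i} (\<lambda>_. count_space UNIV))
    (subprob_algebra (count_space UNIV))" for i
  proof (cases i)
    case 0
    have "measure_pmf \<mu> \<in> space (subprob_algebra (count_space UNIV))"
      by (simp add: space_subprob_algebra measure_pmf.subprob_space_axioms)
    with 0 show ?thesis
      by (simp add: chain_step_def[abs_def])
  next
    case (Suc j)
    have K: "(\<lambda>x. measure_pmf (K x)) \<in> measurable (count_space UNIV)
        (subprob_algebra (count_space UNIV))"
      by (simp add: space_subprob_algebra measure_pmf.subprob_space_axioms)
    have "(\<lambda>\<omega>. \<omega> j) \<in> measurable (PiM {0..<i} (\<lambda>_. count_space UNIV)) (count_space UNIV)"
      using Suc by (intro measurable_component_singleton) auto
    from measurable_compose[OF this K] Suc show ?thesis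
      by (simp add: chain_step_def[abs_def])
  qed
next
  show "prob_space (chain_step \<mu> K i x)"
    if "x \<in> space (PiM {0..<i} (\<lambda>_. count_space UNIV))" for i x
    by (simp add: chain_step_def measure_pmf.prob_space_axioms)
qed

definition chain_law :: "'x pmf \<Rightarrow> ('x \<Rightarrow> 'x pmf) \<Rightarrow> (nat \<Rightarrow> 'x) measure" where
  "chain_law \<mu> K = chain.PF.lim \<mu> K"


subsection \<open>Discounted Markov decision processes\<close>

text \<open>
  The simplex over a finite type \<open>'x\<close> is the type \<open>'x pmf\<close>; accordingly the set of all policies
  is the whole type \<open>'s \<Rightarrow> 'a pmf\<close>. Trajectories are sequences of state-action pairs.
\<close>

definition sa_step :: "('s \<Rightarrow> 'a \<Rightarrow> 's pmf) \<Rightarrow> ('s \<Rightarrow> 'a pmf) \<Rightarrow> 's \<times> 'a \<Rightarrow> ('s \<times> 'a) pmf" where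
  "sa_step P \<pi> = (\<lambda>(s, a). bind_pmf (P s a) (\<lambda>s'. map_pmf (Pair s') (\<pi> s')))"

definition disc_return :: "('s \<Rightarrow> 'a \<Rightarrow> real) \<Rightarrow> real \<Rightarrow> (nat \<Rightarrow> 's \<times> 'a) \<Rightarrow> real" where
  "disc_return r \<gamma> \<omega> = (\<Sum>t. \<gamma> ^ t * r (fst (\<omega> t)) (snd (\<omega> t)))"

definition V_pol :: "('s \<Rightarrow> 'a \<Rightarrow> 's pmf) \<Rightarrow> ('s \<Rightarrow> 'a \<Rightarrow> real) \<Rightarrow> real \<Rightarrow> ('s \<Rightarrow> 'a pmf) \<Rightarrow> 's \<Rightarrow> real"
  where "V_pol P r \<gamma> \<pi> s =
    (LINT \<omega>|chain_law (map_pmf (Pair s) (\<pi> s)) (sa_step P \<pi>). disc_return r \<gamma> \<omega>)"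

definition Q_pol ::
    "('s \<Rightarrow> 'a \<Rightarrow> 's pmf) \<Rightarrow> ('s \<Rightarrow> 'a \<Rightarrow> real) \<Rightarrow> real \<Rightarrow> ('s \<Rightarrow> 'a pmf) \<Rightarrow> 's \<Rightarrow> 'a \<Rightarrow> real"
  where "Q_pol P r \<gamma> \<pi> s a =
    (LINT \<omega>|chain_law (return_pmf (s, a)) (sa_step P \<pi>). disc_return r \<gamma> \<omega>)"

text \<open>The suprema below are attained, so they are the maxima over all policies.\<close>

definition V_opt :: "('s \<Rightarrow> 'a \<Rightarrow> 's pmf) \<Rightarrow> ('s \<Rightarrow> 'a \<Rightarrow> real) \<Rightarrow> real \<Rightarrow> 's \<Rightarrow> real" where
  "V_opt P r \<gamma> s = (SUP \<pi>. V_pol P r \<gamma> \<pi> s)"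

definition Q_opt :: "('s \<Rightarrow> 'a \<Rightarrow> 's pmf) \<Rightarrow> ('s \<Rightarrow> 'a \<Rightarrow> real) \<Rightarrow> real \<Rightarrow> 's \<Rightarrow> 'a \<Rightarrow> real" where
  "Q_opt P r \<gamma> s a = (SUP \<pi>. Q_pol P r \<gamma> \<pi> s a)"

definition opt_actions :: "('s \<Rightarrow> 'a \<Rightarrow> 's pmf) \<Rightarrow> ('s \<Rightarrow> 'a \<Rightarrow> real) \<Rightarrow> real \<Rightarrow> 's \<Rightarrow> 'a set" where
  "opt_actions P r \<gamma> s = {a. Q_opt P r \<gamma> s a = V_opt P r \<gamma> s}"

definition nontrivial_states :: "('s \<Rightarrow> 'a \<Rightarrow> 's pmf) \<Rightarrow> ('s \<Rightarrow> 'a \<Rightarrow> real) \<Rightarrow> real \<Rightarrow> 's set" where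
  "nontrivial_states P r \<gamma> = {s. opt_actions P r \<gamma> s \<noteq> UNIV}"

definition gap_at ::
    "('s::finite \<Rightarrow> 'a::finite \<Rightarrow> 's pmf) \<Rightarrow> ('s \<Rightarrow> 'a \<Rightarrow> real) \<Rightarrow> real \<Rightarrow> 's \<Rightarrow> real" where
  "gap_at P r \<gamma> s = V_opt P r \<gamma> s - (MAX a \<in> - opt_actions P r \<gamma> s. Q_opt P r \<gamma> s a)"

definition gap :: "('s::finite \<Rightarrow> 'a::finite \<Rightarrow> 's pmf) \<Rightarrow> ('s \<Rightarrow> 'a \<Rightarrow> real) \<Rightarrow> real \<Rightarrow> real" where
  "gap P r \<gamma> = (MIN s \<in> nontrivial_states P r \<gamma>. gap_at P r \<gamma> s)"

definition subopt ::
    "('s::finite \<Rightarrow> 'a::finite \<Rightarrow> 's pmf) \<Rightarrow> ('s \<Rightarrow> 'a \<Rightarrow> real) \<Rightarrow> real \<Rightarrow> ('s \<Rightarrow> 'a pmf) \<Rightarrow> real" where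
  "subopt P r \<gamma> \<pi> = (MAX s. \<bar>V_opt P r \<gamma> s - V_pol P r \<gamma> \<pi> s\<bar>)"


subsection \<open>Mirror maps and Bregman divergences\<close>

definition edom :: "(real \<Rightarrow> ereal) \<Rightarrow> real set" where
  "edom \<psi> = {x. \<psi> x < \<infinity>}"

definition epi :: "(real \<Rightarrow> ereal) \<Rightarrow> (real \<times> real) set" where
  "epi \<psi> = {(x, y). \<psi> x \<le> ereal y}"

text \<open>Derivative; only meaningful on the interior of the domain.\<close>

definition ederiv :: "(real \<Rightarrow> ereal) \<Rightarrow> real \<Rightarrow> real" where
  "ederiv \<psi> = deriv (\<lambda>x. real_of_ereal (\<psi> x))"

text \<open>
  Closedness and convexity of an extended-real function are those of its epigraph.
\<close>

definition mirror_map :: "(real \<Rightarrow> ereal) \<Rightarrow> bool" where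
  "mirror_map \<psi> \<longleftrightarrow>
     {0..1} \<subseteq> edom \<psi> \<and>
     (\<forall>x. \<psi> x \<noteq> -\<infinity>) \<and> edom \<psi> \<noteq> {} \<and> closed (epi \<psi>) \<and> convex (epi \<psi>) \<and>
     (\<forall>x \<in> interior (edom \<psi>). (\<lambda>x. real_of_ereal (\<psi> x)) differentiable at x) \<and>
     (\<forall>X l. (\<forall>n. X n \<in> interior (edom \<psi>)) \<and> l \<in> frontier (edom \<psi>) \<and> X \<longlonglongrightarrow> l
        \<longrightarrow> filterlim (\<lambda>n. \<bar>ederiv \<psi> (X n)\<bar>) at_top sequentially) \<and>
     (\<forall>x \<in> interior (edom \<psi>). \<forall>y \<in> interior (edom \<psi>). \<forall>t \<in> {0<..<1}. x \<noteq> y \<longrightarrow>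
        \<psi> ((1 - t) * x + t * y) < ereal (1 - t) * \<psi> x + ereal t * \<psi> y)"

definition separable :: "(real \<Rightarrow> ereal) \<Rightarrow> real ^ 'a \<Rightarrow> ereal" where
  "separable \<psi> p = (\<Sum>a\<in>UNIV. \<psi> (p $ a))"

definition gradient :: "(real ^ 'a \<Rightarrow> ereal) \<Rightarrow> real ^ 'a \<Rightarrow> real ^ 'a" where
  "gradient h q = (THE D. GDERIV (\<lambda>x. real_of_ereal (h x)) q :> D)"

definition bregman :: "(real ^ 'a \<Rightarrow> ereal) \<Rightarrow> real ^ 'a \<Rightarrow> real ^ 'a \<Rightarrow> ereal" where
  "bregman h p q = h p - h q - ereal (gradient h q \<bullet> (p - q))"

definition phi :: "(real \<Rightarrow> ereal) \<Rightarrow> real \<Rightarrow> real" where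
  "phi \<psi> x = - ederiv \<psi> x"

definition chi :: "(real \<Rightarrow> ereal) \<Rightarrow> real \<Rightarrow> real" where
  "chi \<psi> x = ederiv \<psi> (1 - x)"

text \<open>
  Inverses of the restrictions to the open unit interval; these restrictions are bijections onto
  the reals when the derivative of \<open>\<psi>\<close> tends to minus infinity at 0 from the right and to plus
  infinity at 1 from the left.
\<close>

definition phi_inv :: "(real \<Rightarrow> ereal) \<Rightarrow> real \<Rightarrow> real" where
  "phi_inv \<psi> = the_inv_into {0<..<1} (phi \<psi>)"

definition chi_inv :: "(real \<Rightarrow> ereal) \<Rightarrow> real \<Rightarrow> real" where
  "chi_inv \<psi> = the_inv_into {0<..<1} (chi \<psi>)"


subsection \<open>Policy mirror descent\<close>

definition pmf_vec :: "'a pmf \<Rightarrow> real ^ 'a" where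
  "pmf_vec p = (\<chi> a. pmf p a)"

text \<open>
  The next policy maximises the extended-real objective over the whole simplex. That all iterates
  stay in the interior of the domain is a consequence, not part of the definition.
\<close>

definition pmd ::
    "('s \<Rightarrow> 'a::finite \<Rightarrow> 's pmf) \<Rightarrow> ('s \<Rightarrow> 'a \<Rightarrow> real) \<Rightarrow> real \<Rightarrow> (real \<Rightarrow> ereal) \<Rightarrow> real
      \<Rightarrow> (nat \<Rightarrow> 's \<Rightarrow> 'a pmf) \<Rightarrow> bool" where
  "pmd P r \<gamma> \<psi> \<eta> \<pi> \<longleftrightarrow>
     (\<forall>k s. is_arg_max
        (\<lambda>p. ereal (\<eta> * (pmf_vec p \<bullet> (\<chi> a. Q_pol P r \<gamma> (\<pi> k) s a)))
              - bregman (separable \<psi>) (pmf_vec p) (pmf_vec (\<pi> k s)))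
        (\<lambda>p. True) (\<pi> (Suc k) s))"

text \<open>
  The set of indices is nonempty because the values of the iterates converge to the optimal value.
\<close>

definition hit_time ::
    "('s::finite \<Rightarrow> 'a::finite \<Rightarrow> 's pmf) \<Rightarrow> ('s \<Rightarrow> 'a \<Rightarrow> real) \<Rightarrow> real
      \<Rightarrow> (nat \<Rightarrow> 's \<Rightarrow> 'a pmf) \<Rightarrow> real \<Rightarrow> nat" where
  "hit_time P r \<gamma> \<pi> \<sigma> = (LEAST k. subopt P r \<gamma> (\<pi> k) \<le> \<sigma>)"

end

theory Submission
  imports Defs
begin

text \<open>
The derivative of the mirror map turns policy mirror descent into additive updates: writing
\<open>\<theta>\<^sub>k(s,a)\<close> for \<open>\<psi>'\<close> at the probability of \<open>a\<close> in state
\<open>s\<close> at step \<open>k\<close>, stationarity of each step (\<open>dual_step\<close>) says that the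
difference \<open>\<theta>\<^sub>k(s,b) - \<theta>\<^sub>k(s,a)\<close> grows by \<open>\<eta>\<close> times the
difference of the current action values. This needs the maximiser to lie in the open simplex, which
the blow-up of \<open>\<psi>'\<close> at \<open>0\<close> enforces (\<open>max_interior\<close>).

Convergence to the optimal value is obtained qualitatively. The values increase
(\<open>V_mono\<close>) and are bounded, so they converge; an action with a smaller limiting action
value loses all its mass, since its dual difference to a better action diverges. Hence the limit
solves the Bellman optimality equation (\<open>limit_bellman\<close>), and
any such solution is the optimal value function (\<open>bellman_solution_optimal\<close>). From the
hitting time on, all values and action values are within \<open>\<sigma>\<close> of the optimal ones.

The rates come from the same dual differences. From the hitting time on, the difference between an
optimal and a suboptimal action grows per step by at least \<open>\<eta> (\<Delta> - 2 \<sigma>)\<close>,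
and for a pair that attains the gap \<open>\<Delta>\<close> no action gains on the suboptimal one by
more than \<open>\<eta> (\<Delta> + 2 \<sigma>)\<close>. Inverting \<open>\<psi>'\<close> translates this
into bounds for the mass of suboptimal actions, and the performance difference argument
(\<open>subopt_le_suboptimal_mass\<close>, \<open>subopt_ge_action_mass\<close>) translates mass into
suboptimality. The constants record the state of the dual differences at the hitting time.

The value functions are integrals over infinite trajectories; they enter only through the
Bellman equations \<open>V_pol_eq\<close> and \<open>Q_pol_eq\<close>, which follow from the one-coordinate
marginals of the trajectory measure.
\<close>

section \<open>Marginals of the Markov chain and discounted returns\<close>

text \<open>
The recursion advances the initial distribution, which suits the first-step analysis behind the
Bellman equations; \<open>marginal_Suc\<close> is the form that matches the construction of the
trajectory measure.
\<close>

fun marginal :: "'x pmf \<Rightarrow> ('x \<Rightarrow> 'x pmf) \<Rightarrow> nat \<Rightarrow> 'x pmf" where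
  "marginal \<mu> K 0 = \<mu>"
| "marginal \<mu> K (Suc t) = marginal (bind_pmf \<mu> K) K t"

lemma marginal_Suc: "marginal \<mu> K (Suc t) = bind_pmf (marginal \<mu> K t) K"
  by (induction t arbitrary: \<mu>) auto

lemma marginal_bind: "marginal (bind_pmf M N) K t = bind_pmf M (\<lambda>x. marginal (N x) K t)"
  by (induction t arbitrary: N) (auto simp: bind_assoc_pmf)

lemma borel_measurable_coordinate:
  "n \<in> J \<Longrightarrow> (\<lambda>\<omega>. f (\<omega> n)) \<in> borel_measurable (PiM J (\<lambda>_. count_space UNIV))"
  by (rule measurable_compose[OF measurable_component_singleton[of n J "\<lambda>_. count_space UNIV"]])
    simp_all

text \<open>
The kernel that extends a trajectory of length \<open>n + 1\<close> looks only at its last entry, so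
integrating out the newest coordinate advances the law of that last entry by one application
of \<open>K\<close>.
\<close>

lemma nn_integral_chain_prefix:
  fixes f :: "'x \<Rightarrow> ennreal"
  shows "(\<integral>\<^sup>+\<omega>. f (\<omega> n) \<partial>chain.C \<mu> K 0 (Suc n) (\<lambda>_. undefined)) = (\<integral>\<^sup>+x. f x \<partial>marginal \<mu> K n)"
proof (induction n arbitrary: f)
  let ?M = "\<lambda>n. PiM {0..<n} (\<lambda>_. count_space (UNIV :: 'x set))"
  have step: "(\<integral>\<^sup>+\<omega>. f (\<omega> n) \<partial>chain.C \<mu> K 0 (Suc n) (\<lambda>_. undefined))
      = (\<integral>\<^sup>+\<omega>. (\<integral>\<^sup>+x. f x \<partial>chain_step \<mu> K n \<omega>) \<partial>chain.C \<mu> K 0 n (\<lambda>_. undefined))"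
    for n and f :: "'x \<Rightarrow> ennreal"
  proof -
    have f: "(\<lambda>\<omega>. f (\<omega> n)) \<in> borel_measurable (?M (Suc n))"
      by (rule borel_measurable_coordinate) simp
    have eq: "chain.C \<mu> K 0 (Suc n) (\<lambda>_. undefined)
        = chain.C \<mu> K 0 n (\<lambda>_. undefined) \<bind> chain.eP \<mu> K n"
      by simp
    show ?thesis
      unfolding eq
      apply (subst nn_integral_bind[OF f])
       apply (subst measurable_cong_sets[OF _ refl, of _ "?M n"])
        apply (simp add: chain.sets_C space_PiM)
       apply (rule chain.measurable_eP)
      apply (rule nn_integral_cong)
      apply (subst chain.nn_integral_eP)
        apply (simp_all add: f chain.space_C space_PiM)
      done
  qed
  {
    case 0
    show ?case
      by (subst step) (simp add: chain_step_def PiM_empty nn_integral_return)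
  next
    case (Suc n)
    have "(\<integral>\<^sup>+x. f x \<partial>chain_step \<mu> K (Suc n) \<omega>) = (\<integral>\<^sup>+y. f y \<partial>K (\<omega> n))" for \<omega>
      by (simp add: chain_step_def)
    then show ?case
      by (subst step) (simp add: Suc[of "\<lambda>x. \<integral>\<^sup>+y. f y \<partial>K x"] marginal_Suc nn_integral_bind_pmf
        del: marginal.simps chain.C.simps)
  }
qed

lemma sets_chain_law: "sets (chain_law \<mu> K) = sets (PiM UNIV (\<lambda>_. count_space UNIV))"
  by (simp add: chain_law_def)

lemma measurable_chain_law [measurable]:
  "(\<lambda>\<omega>. \<omega> n) \<in> measurable (chain_law \<mu> K) (count_space UNIV)"
  by (simp add: measurable_cong_sets[OF sets_chain_law refl])

lemma nn_integral_chain_law: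
  "(\<integral>\<^sup>+\<omega>. f (\<omega> n) \<partial>chain_law \<mu> K) = (\<integral>\<^sup>+x. f x \<partial>marginal \<mu> K n)"
proof -
  let ?M = "\<lambda>_. count_space (UNIV :: 'x set)" and ?J = "{0..<Suc n}"
  have u: "chain.up_to ?J = Suc n"
    using chain.up_to_iff[of ?J] by (intro antisym) (auto simp: not_less_eq_eq[symmetric] dest: spec)
  have "(\<integral>\<^sup>+\<omega>. f (\<omega> n) \<partial>chain_law \<mu> K) = (\<integral>\<^sup>+\<omega>. f (restrict \<omega> ?J n) \<partial>chain_law \<mu> K)"
    by simp
  also have "\<dots> = (\<integral>\<^sup>+\<omega>. f (\<omega> n) \<partial>distr (chain_law \<mu> K) (PiM ?J ?M) (\<lambda>\<omega>. restrict \<omega> ?J))"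
    by (subst nn_integral_distr) (auto simp: measurable_cong_sets[OF sets_chain_law refl] intro!: borel_measurable_coordinate)
  also have "\<dots> = (\<integral>\<^sup>+\<omega>. f (\<omega> n) \<partial>chain.CI \<mu> K ?J)"
    unfolding chain_law_def by (subst chain.distr_lim) simp_all
  also have "\<dots> = (\<integral>\<^sup>+\<omega>. f (\<omega> n) \<partial>chain.C \<mu> K 0 (Suc n) (\<lambda>_. undefined))"
    unfolding chain.CI_def u
    by (subst nn_integral_distr)
      (auto simp: measurable_cong_sets[OF chain.sets_C refl] space_PiM
        intro!: borel_measurable_coordinate simp del: chain.C.simps)
  finally show ?thesis
    by (simp only: nn_integral_chain_prefix)
qed

text \<open>
The only property of the trajectory measure that the value functions depend on: the discounted
return is a sum of functions of single coordinates.
\<close>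

lemma distr_chain_law:
  "distr (chain_law \<mu> K) (count_space UNIV) (\<lambda>\<omega>. \<omega> n) = marginal \<mu> K n"
proof (rule measure_eqI)
  fix A :: "'a set"
  show "emeasure (distr (chain_law \<mu> K) (count_space UNIV) (\<lambda>\<omega>. \<omega> n)) A = emeasure (marginal \<mu> K n) A"
    using nn_integral_chain_law[where f = "indicator A" and n = n and \<mu> = \<mu> and K = K]
    by (simp add: nn_integral_distr flip: nn_integral_indicator)
qed simp

lemma sum_pmf_UNIV [simp]: "(\<Sum>x\<in>UNIV. pmf p (x::'x::finite)) = 1"
  using sum_pmf_eq_1[of UNIV p] by simp

lemma summable_discounted:
  fixes \<gamma> B :: real and u :: "nat \<Rightarrow> real"
  assumes "0 \<le> \<gamma>" "\<gamma> < 1" "\<And>t. \<bar>u t\<bar> \<le> B"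
  shows "summable (\<lambda>t. \<gamma> ^ t * u t)"
proof (rule summable_comparison_test')
  show "summable (\<lambda>t. \<gamma> ^ t * B)"
    using assms by (intro summable_mult2 summable_geometric) auto
  show "norm (\<gamma> ^ t * u t) \<le> \<gamma> ^ t * B" for t
    using assms by (auto simp: abs_mult intro!: mult_left_mono)
qed

text \<open>
The expected discounted return, written without trajectories and as a function of the initial
distribution, in which it is affine. This is the form in which the Bellman equations are read off.
\<close>

definition disc_value :: "('x \<Rightarrow> real) \<Rightarrow> real \<Rightarrow> ('x \<Rightarrow> 'x pmf) \<Rightarrow> 'x pmf \<Rightarrow> real" where
  "disc_value f \<gamma> K \<mu> = (\<Sum>t. \<gamma> ^ t * measure_pmf.expectation (marginal \<mu> K t) f)"

context
  fixes f :: "'x::finite \<Rightarrow> real" and \<gamma> :: real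
  assumes \<gamma>: "0 \<le> \<gamma>" "\<gamma> < 1"
begin

lemma abs_le_Max_UNIV: "\<bar>f x\<bar> \<le> (MAX x. \<bar>f x\<bar>)"
  by (rule Max_ge) auto

lemma abs_expectation_le_Max: "\<bar>measure_pmf.expectation p f\<bar> \<le> (MAX x. \<bar>f x\<bar>)"
proof -
  have "\<bar>measure_pmf.expectation p f\<bar> \<le> measure_pmf.expectation p (\<lambda>x. \<bar>f x\<bar>)"
    by (rule integral_abs_bound)
  also have "\<dots> \<le> measure_pmf.expectation p (\<lambda>x. MAX x. \<bar>f x\<bar>)"
    by (intro integral_mono integrable_measure_pmf_finite) (auto simp: abs_le_Max_UNIV)
  finally show ?thesis
    by simp
qed

lemma expected_disc_sum:
  "(LINT \<omega>|chain_law \<mu> K. (\<Sum>t. \<gamma> ^ t * f (\<omega> t))) = disc_value f \<gamma> K \<mu>"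
proof -
  define B where "B = (MAX x. \<bar>f x\<bar>)"
  interpret prob_space "chain_law \<mu> K"
    by (rule prob_space_distrD[OF measurable_chain_law[of 0]])
      (simp add: distr_chain_law measure_pmf.prob_space_axioms)
  have int: "integrable (chain_law \<mu> K) (\<lambda>\<omega>. g (\<omega> t))" for g :: "'x \<Rightarrow> real" and t
    by (subst integrable_distr_eq[of "\<lambda>\<omega>. \<omega> t" _ "count_space UNIV" g, symmetric])
      (auto simp: distr_chain_law intro: integrable_measure_pmf_finite)
  have law: "(LINT \<omega>|chain_law \<mu> K. g (\<omega> t)) = measure_pmf.expectation (marginal \<mu> K t) g"
    for g :: "'x \<Rightarrow> real" and t
    by (subst integral_distr[of "\<lambda>\<omega>. \<omega> t" _ "count_space UNIV" g, symmetric])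
      (auto simp: distr_chain_law)
  have norm: "(LINT \<omega>|chain_law \<mu> K. norm (\<gamma> ^ t * f (\<omega> t)))
      = \<gamma> ^ t * measure_pmf.expectation (marginal \<mu> K t) (\<lambda>x. \<bar>f x\<bar>)" for t
    using \<gamma> law[of "\<lambda>x. \<bar>f x\<bar>" t] by (simp add: abs_mult)
  have "(LINT \<omega>|chain_law \<mu> K. (\<Sum>t. \<gamma> ^ t * f (\<omega> t)))
      = (\<Sum>t. LINT \<omega>|chain_law \<mu> K. \<gamma> ^ t * f (\<omega> t))"
  proof (rule integral_suminf)
    show "AE \<omega> in chain_law \<mu> K. summable (\<lambda>t. norm (\<gamma> ^ t * f (\<omega> t)))"
    proof (rule AE_I2)
      fix \<omega>
      have "summable (\<lambda>t. \<gamma> ^ t * \<bar>f (\<omega> t)\<bar>)"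
        by (rule summable_discounted[OF \<gamma>, of _ B]) (simp add: abs_le_Max_UNIV B_def)
      then show "summable (\<lambda>t. norm (\<gamma> ^ t * f (\<omega> t)))"
        using \<gamma> by (simp add: abs_mult)
    qed
    have "\<bar>measure_pmf.expectation p (\<lambda>x. \<bar>f x\<bar>)\<bar> \<le> B" for p
    proof -
      have "measure_pmf.expectation p (\<lambda>x. \<bar>f x\<bar>) \<le> measure_pmf.expectation p (\<lambda>x. B)"
        by (intro integral_mono integrable_measure_pmf_finite) (auto simp: abs_le_Max_UNIV B_def)
      then show ?thesis
        by simp
    qed
    then show "summable (\<lambda>t. LINT \<omega>|chain_law \<mu> K. norm (\<gamma> ^ t * f (\<omega> t)))"
      unfolding norm by (intro summable_discounted \<gamma>)
  qed (simp add: int)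
  then show ?thesis
    by (simp add: disc_value_def law)
qed

lemma summable_disc_value:
  "summable (\<lambda>t. \<gamma> ^ t * measure_pmf.expectation (marginal \<mu> K t) f)"
  by (rule summable_discounted[OF \<gamma>]) (rule abs_expectation_le_Max)

text \<open>
Splitting off the term at time \<open>0\<close> leaves the same series for the chain started one
step later. Together with \<open>disc_value_bind\<close> this is the Bellman evaluation equation.
\<close>

lemma disc_value_step:
  "disc_value f \<gamma> K \<mu> = measure_pmf.expectation \<mu> f + \<gamma> * disc_value f \<gamma> K (bind_pmf \<mu> K)"
  using suminf_split_head[OF summable_disc_value[of \<mu> K]]
  by (simp add: disc_value_def mult.assoc suminf_mult summable_disc_value)

lemma disc_value_bind:
  fixes M :: "'y::finite pmf"
  shows "disc_value f \<gamma> K (bind_pmf M N) = (\<Sum>y\<in>UNIV. pmf M y * disc_value f \<gamma> K (N y))"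
proof -
  have "disc_value f \<gamma> K (bind_pmf M N)
      = (\<Sum>t. \<Sum>y\<in>UNIV. pmf M y * (\<gamma> ^ t * measure_pmf.expectation (marginal (N y) K t) f))"
    unfolding disc_value_def marginal_bind
    by (subst pmf_expectation_bind[of UNIV]) (auto simp: sum_distrib_left mult_ac)
  also have "\<dots> = (\<Sum>y\<in>UNIV. pmf M y * disc_value f \<gamma> K (N y))"
    by (subst suminf_sum)
      (auto simp: disc_value_def suminf_mult[OF summable_disc_value] intro!: summable_mult summable_disc_value)
  finally show ?thesis .
qed

end

section \<open>Bellman equations\<close>

locale mdp =
  fixes P :: "'s::finite \<Rightarrow> 'a::finite \<Rightarrow> 's pmf" and r :: "'s \<Rightarrow> 'a \<Rightarrow> real" and \<gamma> :: real
  assumes reward: "\<And>s a. 0 \<le> r s a" "\<And>s a. r s a \<le> 1"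
    and discount: "0 \<le> \<gamma>" "\<gamma> < 1"
begin

definition backup :: "('s \<Rightarrow> real) \<Rightarrow> 's \<Rightarrow> 'a \<Rightarrow> real" where
  "backup v s a = r s a + \<gamma> * (\<Sum>s'\<in>UNIV. pmf (P s a) s' * v s')"

lemma V_pol_eq: "V_pol P r \<gamma> \<pi> s = (\<Sum>a\<in>UNIV. pmf (\<pi> s) a * Q_pol P r \<gamma> \<pi> s a)"
proof -
  let ?f = "\<lambda>(s, a). r s a"
  have "V_pol P r \<gamma> \<pi> s = disc_value ?f \<gamma> (sa_step P \<pi>) (map_pmf (Pair s) (\<pi> s))"
    unfolding V_pol_def disc_return_def
    by (subst expected_disc_sum[OF discount, symmetric]) (simp add: case_prod_beta)
  also have "\<dots> = (\<Sum>a\<in>UNIV. pmf (\<pi> s) a * disc_value ?f \<gamma> (sa_step P \<pi>) (return_pmf (s, a)))"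
    by (simp add: map_pmf_def disc_value_bind[OF discount])
  also have "\<dots> = (\<Sum>a\<in>UNIV. pmf (\<pi> s) a * Q_pol P r \<gamma> \<pi> s a)"
    unfolding Q_pol_def disc_return_def
    by (subst expected_disc_sum[OF discount, symmetric]) (simp add: case_prod_beta)
  finally show ?thesis .
qed

lemma Q_pol_eq: "Q_pol P r \<gamma> \<pi> = backup (V_pol P r \<gamma> \<pi>)"
proof (intro ext)
  fix s a
  let ?f = "\<lambda>(s, a). r s a" and ?K = "sa_step P \<pi>"
  have V: "V_pol P r \<gamma> \<pi> s = disc_value ?f \<gamma> ?K (map_pmf (Pair s) (\<pi> s))" for s
    unfolding V_pol_def disc_return_def
    by (subst expected_disc_sum[OF discount, symmetric]) (simp add: case_prod_beta)
  have "Q_pol P r \<gamma> \<pi> s a = disc_value ?f \<gamma> ?K (return_pmf (s, a))"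
    unfolding Q_pol_def disc_return_def
    by (subst expected_disc_sum[OF discount, symmetric]) (simp add: case_prod_beta)
  also have "\<dots> = r s a + \<gamma> * disc_value ?f \<gamma> ?K (?K (s, a))"
    by (subst disc_value_step[OF discount]) (simp add: bind_return_pmf)
  also have "\<dots> = backup (V_pol P r \<gamma> \<pi>) s a"
    by (simp add: backup_def sa_step_def disc_value_bind[OF discount] V)
  finally show "Q_pol P r \<gamma> \<pi> s a = backup (V_pol P r \<gamma> \<pi>) s a" .
qed

end

lemma pmf_average_le:
  fixes f :: "'x::finite \<Rightarrow> real"
  assumes "\<And>x. f x \<le> B"
  shows "(\<Sum>x\<in>UNIV. pmf p x * f x) \<le> B"
proof -
  have "(\<Sum>x\<in>UNIV. pmf p x * f x) \<le> (\<Sum>x\<in>UNIV. pmf p x * B)"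
    using assms by (intro sum_mono mult_left_mono) auto
  then show ?thesis
    by (simp flip: sum_distrib_right)
qed

lemma pmf_average_diff_const:
  fixes f :: "'x::finite \<Rightarrow> real"
  shows "(\<Sum>x\<in>UNIV. pmf p x * (c - f x)) = c - (\<Sum>x\<in>UNIV. pmf p x * f x)"
  by (simp add: right_diff_distrib sum_subtractf flip: sum_distrib_right)

text \<open>
Evaluate the one-step bound at a maximiser of \<open>u\<close> with \<open>B\<close> the maximum itself:
\<open>B \<le> M + \<gamma> * B\<close>. All comparisons between value functions below, including the
transfer from one-step advantages to values, are instances for a suitable difference \<open>u\<close>.
\<close>

lemma discounted_max_principle:
  fixes u :: "'s::finite \<Rightarrow> real"
  assumes "\<gamma> < 1" and step: "\<And>s B. (\<And>s'. u s' \<le> B) \<Longrightarrow> u s \<le> M + \<gamma> * B"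
  shows "u s \<le> M / (1 - \<gamma>)"
proof -
  define B where "B = Max (range u)"
  have le: "u s' \<le> B" for s'
    by (simp add: B_def)
  have "B \<in> range u"
    unfolding B_def by (rule Max_in) auto
  then obtain s0 where "B = u s0"
    by auto
  with step[OF le, of s0] have "B * (1 - \<gamma>) \<le> M"
    by (simp add: algebra_simps)
  with le[of s] \<open>\<gamma> < 1\<close> show ?thesis
    by (simp add: pos_le_divide_eq order.trans[OF mult_right_mono])
qed

context mdp
begin

lemma backup_diff_le:
  assumes "\<And>s'. v s' - w s' \<le> B"
  shows "backup v s a - backup w s a \<le> \<gamma> * B"
proof -
  have "backup v s a - backup w s a = \<gamma> * (\<Sum>s'\<in>UNIV. pmf (P s a) s' * (v s' - w s'))"
    by (simp add: backup_def right_diff_distrib sum_subtractf)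
  also have "\<dots> \<le> \<gamma> * B"
    using discount assms by (intro mult_left_mono pmf_average_le)
  finally show ?thesis .
qed

lemma backup_mono: "(\<And>s. v s \<le> w s) \<Longrightarrow> backup v s a \<le> backup w s a"
  using backup_diff_le[of v w 0 s a] by simp

lemma V_pol_backup: "V_pol P r \<gamma> \<pi> s = (\<Sum>a\<in>UNIV. pmf (\<pi> s) a * backup (V_pol P r \<gamma> \<pi>) s a)"
  using V_pol_eq[of \<pi> s] by (simp add: Q_pol_eq)

lemma V_pol_le: "V_pol P r \<gamma> \<pi> s \<le> 1 / (1 - \<gamma>)"
proof (rule discounted_max_principle[OF discount(2)])
  fix s B assume B: "\<And>s'. V_pol P r \<gamma> \<pi> s' \<le> B"
  have "backup (V_pol P r \<gamma> \<pi>) s a \<le> 1 + \<gamma> * B" for a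
    unfolding backup_def using reward discount B
    by (intro add_mono mult_left_mono pmf_average_le) auto
  then show "V_pol P r \<gamma> \<pi> s \<le> 1 + \<gamma> * B"
    by (subst V_pol_backup) (rule pmf_average_le)
qed

text \<open>
A function that does not exceed its own one-step evaluation under \<open>\<pi>\<close> lies below the
value of \<open>\<pi>\<close>. Taking for it the value of another policy gives policy improvement.
\<close>

lemma le_V_pol:
  assumes sub: "\<And>s. v s \<le> (\<Sum>a\<in>UNIV. pmf (\<pi> s) a * backup v s a)"
  shows "v s \<le> V_pol P r \<gamma> \<pi> s"
proof -
  have "v s - V_pol P r \<gamma> \<pi> s \<le> 0 / (1 - \<gamma>)"
  proof (rule discounted_max_principle[OF discount(2)])
    fix s B assume B: "\<And>s'. v s' - V_pol P r \<gamma> \<pi> s' \<le> B"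
    have "v s - V_pol P r \<gamma> \<pi> s
        \<le> (\<Sum>a\<in>UNIV. pmf (\<pi> s) a * (backup v s a - backup (V_pol P r \<gamma> \<pi>) s a))"
      using sub[of s] V_pol_backup[of \<pi> s] by (simp add: right_diff_distrib sum_subtractf)
    also have "\<dots> \<le> \<gamma> * B"
      by (intro pmf_average_le backup_diff_le B)
    finally show "v s - V_pol P r \<gamma> \<pi> s \<le> 0 + \<gamma> * B"
      by simp
  qed
  then show ?thesis
    by simp
qed

lemma V_pol_nonneg: "0 \<le> V_pol P r \<gamma> \<pi> s"
  by (rule le_V_pol) (simp add: backup_def sum_nonneg reward)

lemma V_pol_le_of_superharmonic:
  assumes super: "\<And>s a. backup v s a \<le> v s"
  shows "V_pol P r \<gamma> \<pi> s \<le> v s"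
proof -
  have "V_pol P r \<gamma> \<pi> s - v s \<le> 0 / (1 - \<gamma>)"
  proof (rule discounted_max_principle[OF discount(2)])
    fix s B assume B: "\<And>s'. V_pol P r \<gamma> \<pi> s' - v s' \<le> B"
    have "backup (V_pol P r \<gamma> \<pi>) s a \<le> v s + \<gamma> * B" for a
      using backup_diff_le[of "V_pol P r \<gamma> \<pi>" v B s a] B super[of s a] by simp
    then have "V_pol P r \<gamma> \<pi> s \<le> v s + \<gamma> * B"
      by (subst V_pol_backup) (rule pmf_average_le)
    then show "V_pol P r \<gamma> \<pi> s - v s \<le> 0 + \<gamma> * B"
      by simp
  qed
  then show ?thesis
    by simp
qed

text \<open>
The verification principle: every policy is bounded by a solution of the Bellman optimality
equation, and a deterministic policy that picks a maximising action attains it in every state at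
once. So the suprema that define the optimal values are attained, and a solution
found in any way (below: as a limit) identifies them.
\<close>

lemma bellman_solution_optimal:
  assumes v: "\<And>s. v s = (MAX a. backup v s a)"
  shows "V_opt P r \<gamma> = v" "Q_opt P r \<gamma> = backup v"
proof -
  have le: "backup v s a \<le> v s" for s a
    by (subst v[of s]) simp
  have "\<exists>a. backup v s a = v s" for s
  proof -
    have "v s \<in> range (backup v s)"
      by (subst v) (rule Max_in, auto)
    then show ?thesis
      by auto
  qed
  then obtain act where act: "\<And>s. backup v s (act s) = v s"
    by metis
  define greedy where "greedy s = return_pmf (act s)" for s
  have le_v: "V_pol P r \<gamma> \<pi> s \<le> v s" for \<pi> s
    using le by (rule V_pol_le_of_superharmonic)
  have "v s \<le> V_pol P r \<gamma> greedy s" for s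
    by (rule le_V_pol) (simp add: greedy_def act indicator_def if_distrib[of "\<lambda>x. x * _"] sum.If_cases)
  then have V_greedy: "V_pol P r \<gamma> greedy = v"
    using le_v by (intro ext antisym)
  show "V_opt P r \<gamma> = v"
    unfolding V_opt_def
    by (intro ext cSup_eq_maximum) (auto simp: le_v intro!: rev_image_eqI[of greedy] simp: V_greedy)
  show "Q_opt P r \<gamma> = backup v"
    unfolding Q_opt_def Q_pol_eq
    by (intro ext cSup_eq_maximum)
      (auto simp: le_v intro!: backup_mono rev_image_eqI[of greedy] simp: V_greedy)
qed

lemma gap_facts:
  assumes ne: "nontrivial_states P r \<gamma> \<noteq> {}"
  shows gap_le: "a \<notin> opt_actions P r \<gamma> s \<Longrightarrow> gap P r \<gamma> \<le> V_opt P r \<gamma> s - Q_opt P r \<gamma> s a"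
    and gap_attained: "\<exists>s a. V_opt P r \<gamma> s - Q_opt P r \<gamma> s a = gap P r \<gamma>"
proof -
  show "gap P r \<gamma> \<le> V_opt P r \<gamma> s - Q_opt P r \<gamma> s a" if a: "a \<notin> opt_actions P r \<gamma> s"
  proof -
    have "gap P r \<gamma> \<le> gap_at P r \<gamma> s"
      unfolding gap_def using a by (intro Min_le) (auto simp: nontrivial_states_def)
    also have "\<dots> \<le> V_opt P r \<gamma> s - Q_opt P r \<gamma> s a"
      unfolding gap_at_def using a by (intro diff_left_mono Max_ge) auto
    finally show ?thesis .
  qed
  have "gap P r \<gamma> \<in> gap_at P r \<gamma> ` nontrivial_states P r \<gamma>"
    unfolding gap_def using ne by (intro Min_in) auto
  then obtain s where s: "s \<in> nontrivial_states P r \<gamma>" "gap P r \<gamma> = gap_at P r \<gamma> s"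
    by auto
  have "(MAX a \<in> - opt_actions P r \<gamma> s. Q_opt P r \<gamma> s a) \<in> Q_opt P r \<gamma> s ` (- opt_actions P r \<gamma> s)"
    using s by (intro Max_in) (auto simp: nontrivial_states_def)
  then obtain a where "(MAX a \<in> - opt_actions P r \<gamma> s. Q_opt P r \<gamma> s a) = Q_opt P r \<gamma> s a"
    by auto
  then show "\<exists>s a. V_opt P r \<gamma> s - Q_opt P r \<gamma> s a = gap P r \<gamma>"
    using s(2) unfolding gap_at_def by metis
qed

end

section \<open>Steep mirror maps\<close>

text \<open>
Below, \<open>g\<close> is the finite part of \<open>\<psi>\<close> and \<open>d\<close> its derivative. Most
facts come from a single inequality, the supporting line \<open>tangent\<close>: its base point must
be interior, but the point of comparison may be an endpoint of the domain, where \<open>g\<close> has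
no derivative.
\<close>

locale steep_mirror_map =
  fixes \<psi> :: "real \<Rightarrow> ereal"
  assumes mirror: "mirror_map \<psi>"
    and steep_0: "filterlim (ederiv \<psi>) at_bot (at_right 0)"
    and steep_1: "filterlim (ederiv \<psi>) at_top (at_left 1)"
begin

abbreviation g :: "real \<Rightarrow> real" where "g x \<equiv> real_of_ereal (\<psi> x)"
abbreviation d :: "real \<Rightarrow> real" where "d \<equiv> ederiv \<psi>"
abbreviation D :: "real set" where "D \<equiv> edom \<psi>"

lemma unit_subset_dom: "{0..1} \<subseteq> D"
  using mirror by (simp add: mirror_map_def)

lemma psi_eq: "x \<in> D \<Longrightarrow> \<psi> x = ereal (g x)"
  using mirror by (cases "\<psi> x") (auto simp: mirror_map_def edom_def)

lemma convex_dom_g: "convex_on D g"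
proof -
  have epi: "convex (epi \<psi>)"
    using mirror by (simp add: mirror_map_def)
  have key: "(1 - t) * x + t * y \<in> D \<and> g ((1 - t) * x + t * y) \<le> (1 - t) * g x + t * g y"
    if "x \<in> D" "y \<in> D" "0 \<le> t" "t \<le> 1" for x y t
  proof -
    have "(x, g x) \<in> epi \<psi>" "(y, g y) \<in> epi \<psi>"
      using that psi_eq by (auto simp: epi_def)
    then have "(1 - t) *\<^sub>R (x, g x) + t *\<^sub>R (y, g y) \<in> epi \<psi>"
      using epi that unfolding convex_alt by blast
    then have *: "\<psi> ((1 - t) * x + t * y) \<le> ereal ((1 - t) * g x + t * g y)"
      by (simp add: epi_def)
    then have "(1 - t) * x + t * y \<in> D"
      by (auto simp: edom_def le_less_trans)
    with * psi_eq show ?thesis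
      by (metis ereal_less_eq(3))
  qed
  show ?thesis
    using key by (intro convex_onI) (auto simp: convex_alt)
qed

lemma deriv_g: "x \<in> interior D \<Longrightarrow> (g has_real_derivative d x) (at x)"
  using mirror unfolding mirror_map_def ederiv_def
  by (simp add: DERIV_deriv_iff_real_differentiable)

lemma tangent:
  assumes "x \<in> interior D" "y \<in> D"
  shows "g x + d x * (y - x) \<le> g y"
proof -
  have "connected D"
    using convex_dom_g convex_connected by (auto simp: convex_on_def)
  then show ?thesis
    using convex_on_imp_above_tangent[OF convex_dom_g _ assms, of "d x"] deriv_g[OF assms(1)]
    by (simp add: has_field_derivative_at_within)
qed

lemma d_mono: "x \<in> interior D \<Longrightarrow> y \<in> interior D \<Longrightarrow> x \<le> y \<Longrightarrow> d x \<le> d y"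
proof (cases "x = y")
  case False
  assume xy: "x \<in> interior D" "y \<in> interior D" "x \<le> y"
  then have "(d y - d x) * (y - x) \<ge> 0"
    using tangent[of x y] tangent[of y x] subsetD[OF interior_subset[of D]]
    by (auto simp: algebra_simps)
  with False xy show ?thesis
    by (simp add: zero_le_mult_iff)
qed simp

text \<open>
At an interior point the derivative is finite and bounds the derivative to its right from below,
which is incompatible with the blow-up. Hence the interior of the domain meets
\<open>{0..1}\<close> exactly in \<open>{0<..<1}\<close>.
\<close>

lemma zero_notin_interior: "0 \<notin> interior D"
proof
  assume 0: "0 \<in> interior D"
  have "\<forall>\<^sub>F x in at_right 0. d x < d 0"
    using steep_0 by (simp add: filterlim_at_bot_dense)
  moreover have "\<forall>\<^sub>F x in at_right 0. x \<in> {0<..<1::real}"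
    by (rule eventually_at_right_real) simp
  ultimately have "\<forall>\<^sub>F x in at_right (0::real). False"
  proof eventually_elim
    case (elim x)
    have "x \<in> interior D"
      using elim unit_subset_dom interior_mono[of "{0..1}" D] by auto
    then show ?case
      using d_mono[OF 0, of x] elim by auto
  qed
  then show False
    by (simp add: trivial_limit_at_right_real)
qed

lemma one_notin_interior: "1 \<notin> interior D"
proof
  assume 1: "1 \<in> interior D"
  have "\<forall>\<^sub>F x in at_left 1. d x > d 1"
    using steep_1 by (simp add: filterlim_at_top_dense)
  moreover have "\<forall>\<^sub>F x in at_left 1. x \<in> {0<..<1::real}"
    by (rule eventually_at_left_real) simp
  ultimately have "\<forall>\<^sub>F x in at_left (1::real). False"
  proof eventually_elim
    case (elim x)
    have "x \<in> interior D"
      using elim unit_subset_dom interior_mono[of "{0..1}" D] by auto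
    then show ?case
      using d_mono[OF _ 1, of x] elim by auto
  qed
  then show False
    by (simp add: trivial_limit_at_left_real)
qed

lemma open_unit_interior: "x \<in> {0<..<1} \<Longrightarrow> x \<in> interior D"
  using unit_subset_dom interior_mono[of "{0..1}" D] by auto

lemma unit_interior_iff: "x \<in> {0..1} \<Longrightarrow> x \<in> interior D \<longleftrightarrow> x \<in> {0<..<1}"
  using zero_notin_interior one_notin_interior open_unit_interior[of x]
  by (cases "x = 0"; cases "x = 1") auto

lemma d_strict_mono:
  assumes "x \<in> {0<..<1}" "y \<in> {0<..<1}" "x < y"
  shows "d x < d y"
proof (rule ccontr)
  assume "\<not> d x < d y"
  moreover have I: "x \<in> interior D" "y \<in> interior D"
    using assms open_unit_interior by auto
  ultimately have eq: "d x = d y"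
    using d_mono[of x y] assms by auto
  let ?m = "(1 - 1/2) * x + 1/2 * y"
  have m: "?m \<in> D"
    using assms unit_subset_dom by (auto simp: subset_iff)
  have "\<psi> ?m < ereal (1 - 1/2) * \<psi> x + ereal (1/2) * \<psi> y"
  proof -
    have "\<forall>x \<in> interior D. \<forall>y \<in> interior D. \<forall>t \<in> {0<..<1}. x \<noteq> y \<longrightarrow>
        \<psi> ((1 - t) * x + t * y) < ereal (1 - t) * \<psi> x + ereal t * \<psi> y"
      using mirror by (simp add: mirror_map_def)
    from this[rule_format, OF I, of "1/2"] show ?thesis
      using assms by simp
  qed
  then have "ereal (g ?m) < ereal ((1 - 1/2) * g x + 1/2 * g y)"
    using psi_eq[OF m] psi_eq[of x] psi_eq[of y] subsetD[OF interior_subset I(1)]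
      subsetD[OF interior_subset I(2)]
    by (metis plus_ereal.simps(1) times_ereal.simps(1))
  then have "g ?m < (g x + g y) / 2"
    by simp
  \<comment> \<open>Equal slopes at both ends push the midpoint up to the chord, against strict convexity.\<close>
  moreover have "2 * g ?m \<ge> g x + g y"
    using tangent[OF I(1) m] tangent[OF I(2) m] eq by (simp add: algebra_simps)
  ultimately show False
    by simp
qed

lemma d_less_iff: "x \<in> {0<..<1} \<Longrightarrow> y \<in> {0<..<1} \<Longrightarrow> d x < d y \<longleftrightarrow> x < y"
  using d_strict_mono[of x y] d_strict_mono[of y x] by (cases x y rule: linorder_cases) auto

text \<open>
A derivative has the intermediate value property: a minimiser of \<open>g x - c * x\<close> on an
interval whose end slopes lie on either side of \<open>c\<close> cannot be an end point, so the
slope there is \<open>c\<close>.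
\<close>

lemma d_surj: "\<exists>x\<in>{0<..<1}. d x = c"
proof -
  have "\<forall>\<^sub>F x in at_right 0. d x < c \<and> x \<in> {0<..<1}"
    using steep_0 by (intro eventually_conj eventually_at_right_real) (simp_all add: filterlim_at_bot_dense)
  then obtain a where a: "d a < c" "0 < a" "a < 1"
    using eventually_happens[of _ "at_right (0::real)"] by (auto simp: trivial_limit_at_right_real)
  have "\<forall>\<^sub>F x in at_left 1. c < d x \<and> x \<in> {0<..<1}"
    using steep_1 by (intro eventually_conj eventually_at_left_real) (simp_all add: filterlim_at_top_dense)
  then obtain b where b: "c < d b" "0 < b" "b < 1"
    using eventually_happens[of _ "at_left (1::real)"] by (auto simp: trivial_limit_at_left_real)
  have "a < b"
    using a b d_less_iff[of a b] by auto
  define h where "h x = g x - c * x" for x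
  have h': "(h has_real_derivative (d x - c)) (at x)" if "x \<in> {a..b}" for x
    unfolding h_def using that a b by (auto intro!: derivative_eq_intros deriv_g open_unit_interior)
  have cont: "continuous_on {a..b} h"
    using h' by (intro continuous_at_imp_continuous_on ballI DERIV_isCont)
  obtain x where x: "x \<in> {a..b}" and min: "\<And>y. y \<in> {a..b} \<Longrightarrow> h x \<le> h y"
    using continuous_attains_inf[OF compact_Icc _ cont] \<open>a < b\<close> by auto
  have "x \<noteq> a"
  proof
    assume "x = a"
    have "\<exists>e>0. \<forall>t>0. t < e \<longrightarrow> h (a + t) < h a"
      using h'[of a] a \<open>a < b\<close> by (intro DERIV_neg_dec_right[of _ "d a - c"]) auto
    then obtain e where e: "e > 0" "\<And>t. t > 0 \<Longrightarrow> t < e \<Longrightarrow> h (a + t) < h a"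
      by auto
    define t where "t = Orderings.min (e / 2) (b - a)"
    have "0 < t" "t < e" "t \<le> b - a"
      using \<open>e > 0\<close> \<open>a < b\<close> by (auto simp: t_def)
    with e(2)[of t] min[of "a + t"] \<open>x = a\<close> show False
      by simp
  qed
  moreover have "x \<noteq> b"
  proof
    assume "x = b"
    have "\<exists>e>0. \<forall>t>0. t < e \<longrightarrow> h (b - t) < h b"
      using h'[of b] b \<open>a < b\<close> by (intro DERIV_pos_inc_left[of _ "d b - c"]) auto
    then obtain e where e: "e > 0" "\<And>t. t > 0 \<Longrightarrow> t < e \<Longrightarrow> h (b - t) < h b"
      by auto
    define t where "t = Orderings.min (e / 2) (b - a)"
    have "0 < t" "t < e" "t \<le> b - a"
      using \<open>e > 0\<close> \<open>a < b\<close> by (auto simp: t_def)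
    with e(2)[of t] min[of "b - t"] \<open>x = b\<close> show False
      by simp
  qed
  ultimately have "a < x" "x < b"
    using x by auto
  then have "d x - c = 0"
    using min by (intro DERIV_local_min[OF h'[OF x], of "Orderings.min (x - a) (b - x)"]) (auto simp: abs_if split: if_splits)
  then show ?thesis
    using \<open>a < x\<close> \<open>x < b\<close> a b by (intro bexI[of _ x]) auto
qed

lemma phi_inv_props:
  shows phi_inv_in: "phi_inv \<psi> c \<in> {0<..<1}" and d_phi_inv: "d (phi_inv \<psi> c) = - c"
proof -
  have inj: "inj_on (phi \<psi>) {0<..<1}"
  proof (rule linorder_inj_onI)
    fix x y :: real assume "x < y" "x \<in> {0<..<1}" "y \<in> {0<..<1}"
    then show "phi \<psi> x \<noteq> phi \<psi> y"
      using d_strict_mono[of x y] by (simp add: phi_def)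
  qed auto
  obtain x where x: "x \<in> {0<..<1}" "d x = - c"
    using d_surj by blast
  then have "c \<in> phi \<psi> ` {0<..<1}"
    by (intro rev_image_eqI[of x]) (auto simp: phi_def)
  then have "phi_inv \<psi> c \<in> {0<..<1}" "phi \<psi> (phi_inv \<psi> c) = c"
    unfolding phi_inv_def using the_inv_into_into[OF inj _ order_refl] f_the_inv_into_f[OF inj] by auto
  then show "phi_inv \<psi> c \<in> {0<..<1}" "d (phi_inv \<psi> c) = - c"
    by (auto simp: phi_def)
qed

lemma chi_inv_props:
  shows chi_inv_in: "chi_inv \<psi> c \<in> {0<..<1}" and d_chi_inv: "d (1 - chi_inv \<psi> c) = c"
proof -
  have inj: "inj_on (chi \<psi>) {0<..<1}"
  proof (rule linorder_inj_onI)
    fix x y :: real assume "x < y" "x \<in> {0<..<1}" "y \<in> {0<..<1}"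
    then have "d (1 - y) < d (1 - x)"
      by (intro d_strict_mono) auto
    then show "chi \<psi> x \<noteq> chi \<psi> y"
      by (simp add: chi_def)
  qed auto
  obtain x where x: "x \<in> {0<..<1}" "d x = c"
    using d_surj by blast
  then have "c \<in> chi \<psi> ` {0<..<1}"
    by (intro rev_image_eqI[of "1 - x"]) (auto simp: chi_def)
  then show "chi_inv \<psi> c \<in> {0<..<1}" "d (1 - chi_inv \<psi> c) = c"
    unfolding chi_inv_def using the_inv_into_into[OF inj _ order_refl] f_the_inv_into_f[OF inj]
    by (auto simp: chi_def)
qed

lemma phi_inv_le: "x \<in> {0<..<1} \<Longrightarrow> - d x \<le> c \<Longrightarrow> phi_inv \<psi> c \<le> x"
  using d_less_iff[of x "phi_inv \<psi> c"] phi_inv_in[of c] d_phi_inv[of c] by auto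

lemma le_phi_inv: "x \<in> {0<..<1} \<Longrightarrow> c \<le> - d x \<Longrightarrow> x \<le> phi_inv \<psi> c"
  using d_less_iff[of "phi_inv \<psi> c" x] phi_inv_in[of c] d_phi_inv[of c] by auto

lemma le_chi_inv: "x \<in> {0<..<1} \<Longrightarrow> c \<le> d x \<Longrightarrow> 1 - x \<le> chi_inv \<psi> c"
  using d_less_iff[of x "1 - chi_inv \<psi> c"] chi_inv_in[of c] d_chi_inv[of c] by auto

text \<open>
If the difference grows without bound then either \<open>d (x k)\<close> is large, so that \<open>x k\<close>
is near \<open>1\<close> and leaves no mass for \<open>y k\<close>, or \<open>d (y k)\<close> is very
negative, so that \<open>y k\<close> is near \<open>0\<close>.
\<close>

lemma tendsto_0_of_d_diff:
  assumes "\<And>k. x k \<in> {0<..<1}" "\<And>k. y k \<in> {0<..<1}" "\<And>k. x k + y k \<le> 1"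
    and "filterlim (\<lambda>k. d (x k) - d (y k)) at_top F"
  shows "(y \<longlongrightarrow> 0) F"
proof (rule order_tendstoI)
  fix e :: real assume "e < 0"
  then show "\<forall>\<^sub>F k in F. e < y k"
    using assms(2) by (intro always_eventually allI less_trans[OF \<open>e < 0\<close>]) auto
next
  fix e :: real assume "0 < e"
  define \<epsilon> where "\<epsilon> = min e (1/2)"
  have \<epsilon>: "0 < \<epsilon>" "\<epsilon> < 1" "\<epsilon> \<le> e"
    using \<open>0 < e\<close> by (auto simp: \<epsilon>_def)
  have "\<forall>\<^sub>F k in F. d (1 - \<epsilon>) - d \<epsilon> < d (x k) - d (y k)"
    using assms(4) by (simp add: filterlim_at_top_dense)
  then show "\<forall>\<^sub>F k in F. y k < e"
  proof eventually_elim
    case (elim k)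
    have "y k < \<epsilon>"
    proof (rule ccontr)
      assume "\<not> y k < \<epsilon>"
      then have "x k \<le> 1 - \<epsilon>" "\<epsilon> \<le> y k"
        using assms(3)[of k] by auto
      then have "d (x k) \<le> d (1 - \<epsilon>)" "d \<epsilon> \<le> d (y k)"
        using assms(1,2)[of k] \<epsilon> by (auto intro!: d_mono open_unit_interior)
      with elim show False
        by simp
    qed
    with \<epsilon> show ?case
      by simp
  qed
qed

end

section \<open>The mirror descent step\<close>

lemma pmf_of_weights:
  fixes w :: "'a::finite \<Rightarrow> real"
  assumes "\<And>a. 0 \<le> w a" "(\<Sum>a\<in>UNIV. w a) = 1"
  shows "\<exists>p. \<forall>a. pmf p a = w a"
proof
  have "(\<integral>\<^sup>+a. ennreal (w a) \<partial>count_space UNIV) = 1"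
    using assms by (simp add: nn_integral_count_space_finite sum_ennreal)
  then show "\<forall>a. pmf (embed_pmf w) a = w a"
    using assms by (simp add: pmf_embed_pmf)
qed

lemma pmf_transfer:
  fixes p :: "'a::finite pmf"
  assumes "a \<noteq> b" "0 \<le> pmf p a + t" "0 \<le> pmf p b - t"
  shows "\<exists>p'. (\<forall>c. pmf p' c = ((pmf p)(a := pmf p a + t, b := pmf p b - t)) c)"
proof (rule pmf_of_weights)
  have "(\<Sum>c\<in>UNIV. f c) = f a + f b + (\<Sum>c\<in>UNIV - {a, b}. f c)" for f :: "'a \<Rightarrow> real"
    using \<open>a \<noteq> b\<close> by (subst sum.subset_diff[of "{a, b}"]) (auto simp: add.commute)
  note split = this
  show "(\<Sum>c\<in>UNIV. ((pmf p)(a := pmf p a + t, b := pmf p b - t)) c) = 1"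
    using split[of "pmf p"] \<open>a \<noteq> b\<close> by (subst split) simp
qed (use assms in auto)

context steep_mirror_map
begin

lemma separable_eq:
  fixes x :: "real ^ 'a::finite"
  assumes "\<And>a. x $ a \<in> D"
  shows "separable \<psi> x = ereal (\<Sum>a\<in>UNIV. g (x $ a))"
proof -
  have "separable \<psi> x = (\<Sum>a\<in>UNIV. ereal (g (x $ a)))"
    unfolding separable_def using assms psi_eq by (intro sum.cong) auto
  then show ?thesis
    by simp
qed

lemma gradient_separable:
  fixes q :: "real ^ 'a::finite"
  assumes q: "\<And>a. q $ a \<in> interior D"
  shows "gradient (separable \<psi>) q = (\<chi> a. d (q $ a))"
proof -
  let ?h = "\<lambda>x :: real ^ 'a. real_of_ereal (separable \<psi> x)" and ?G = "\<chi> a. d (q $ a)"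
  have "((\<lambda>x :: real ^ 'a. \<Sum>a\<in>UNIV. g (x $ a)) has_derivative (\<lambda>v. \<Sum>a\<in>UNIV. d (q $ a) * v $ a)) (at q)"
  proof (rule has_derivative_sum)
    fix a :: 'a
    have "((\<lambda>x. x $ a) has_derivative (\<lambda>v. v $ a)) (at q)"
      by (rule bounded_linear_imp_has_derivative) (rule bounded_linear_vec_nth)
    from has_derivative_compose[OF this, of g "(*) (d (q $ a))"] deriv_g[OF q[of a]]
    show "((\<lambda>x. g (x $ a)) has_derivative (\<lambda>v. d (q $ a) * v $ a)) (at q)"
      by (simp add: has_field_derivative_def)
  qed
  then have "(?h has_derivative (\<lambda>v. \<Sum>a\<in>UNIV. d (q $ a) * v $ a)) (at q)"
  proof (rule has_derivative_transform_within_open)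
    show "open (\<Inter>a. (\<lambda>x :: real ^ 'a. x $ a) -` interior D)"
      by (intro open_INT ballI open_vimage_vec_nth) auto
    show "q \<in> (\<Inter>a. (\<lambda>x. x $ a) -` interior D)"
      using q by auto
    show "(\<Sum>a\<in>UNIV. g (x $ a)) = ?h x" if "x \<in> (\<Inter>a. (\<lambda>x. x $ a) -` interior D)" for x :: "real ^ 'a"
      using that subsetD[OF interior_subset[of D]] by (subst separable_eq) auto
  qed
  then have G: "GDERIV ?h q :> ?G"
    by (simp add: gderiv_def inner_vec_def mult.commute)
  show ?thesis
    unfolding gradient_def
  proof (rule the_equality, rule G)
    fix G' assume "GDERIV ?h q :> G'"
    with G have "(\<lambda>v. v \<bullet> G') = (\<lambda>v. v \<bullet> ?G)"
      unfolding gderiv_def by (rule has_derivative_unique[rotated])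
    then show "G' = ?G"
      by (metis vector_eq_ldot)
  qed
qed

text \<open>
The real-valued form of the mirror descent objective, taken on all real weight vectors and written
as one sum over actions so that terms untouched by a perturbation cancel.
\<close>

definition objective :: "real \<Rightarrow> ('a::finite \<Rightarrow> real) \<Rightarrow> 'a pmf \<Rightarrow> ('a \<Rightarrow> real) \<Rightarrow> real" where
  "objective \<eta> Q q w =
     (\<Sum>a\<in>UNIV. \<eta> * (w a * Q a) - g (w a) + g (pmf q a) + d (pmf q a) * (w a - pmf q a))"

lemma objective_eq:
  fixes p q :: "'a::finite pmf"
  assumes q: "\<And>a. pmf q a \<in> interior D"
  shows "ereal (\<eta> * (pmf_vec p \<bullet> (\<chi> a. Q a))) - bregman (separable \<psi>) (pmf_vec p) (pmf_vec q)
    = ereal (objective \<eta> Q q (pmf p))"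
proof -
  have "pmf p a \<in> D" "pmf q a \<in> D" for p q :: "'a pmf" and a
    using unit_subset_dom by (auto simp: subset_iff pmf_le_1)
  then show ?thesis
    unfolding bregman_def using q
    by (simp add: separable_eq gradient_separable pmf_vec_def inner_vec_def objective_def
        sum.distrib sum_subtractf sum_distrib_left)
qed

context
  fixes \<eta> :: real and Q :: "'a::finite \<Rightarrow> real" and p q :: "'a pmf"
  assumes q: "\<And>a. pmf q a \<in> {0<..<1}"
    and max: "is_arg_max (\<lambda>p. ereal (\<eta> * (pmf_vec p \<bullet> (\<chi> a. Q a)))
              - bregman (separable \<psi>) (pmf_vec p) (pmf_vec q)) (\<lambda>p. True) p"
begin

lemma max_objective: "objective \<eta> Q q (pmf p') \<le> objective \<eta> Q q (pmf p)"
proof -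
  have "\<And>a. pmf q a \<in> interior D"
    using q open_unit_interior by blast
  with max show ?thesis
    by (simp add: is_arg_max_def objective_eq not_less)
qed

text \<open>
The maximiser is compared only with distributions obtained by shifting mass \<open>t\<close> from
\<open>b\<close> to \<open>a\<close>. These stay in the simplex, and their directions span its tangent
space, so they carry the full first-order optimality condition.
\<close>

lemma max_pairwise:
  assumes "a \<noteq> b" "0 \<le> pmf p a + t" "0 \<le> pmf p b - t"
  shows "t * (\<eta> * (Q a - Q b) + d (pmf q a) - d (pmf q b))
    \<le> (g (pmf p a + t) - g (pmf p a)) + (g (pmf p b - t) - g (pmf p b))"
proof -
  obtain p' where p': "\<And>c. pmf p' c = ((pmf p)(a := pmf p a + t, b := pmf p b - t)) c"
    using pmf_transfer[OF assms] by auto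
  have split: "(\<Sum>c\<in>UNIV. f c) = f a + f b + (\<Sum>c\<in>UNIV - {a, b}. f c)" for f :: "'a \<Rightarrow> real"
    using \<open>a \<noteq> b\<close> by (subst sum.subset_diff[of "{a, b}"]) (auto simp: add.commute)
  let ?f = "\<lambda>x c. \<eta> * (x * Q c) - g x + g (pmf q c) + d (pmf q c) * (x - pmf q c)"
  have rest: "(\<Sum>c\<in>UNIV - {a, b}. ?f (pmf p' c) c) = (\<Sum>c\<in>UNIV - {a, b}. ?f (pmf p c) c)"
    by (rule sum.cong) (auto simp: p')
  have "(\<Sum>c\<in>UNIV. ?f (pmf p' c) c) \<le> (\<Sum>c\<in>UNIV. ?f (pmf p c) c)"
    using max_objective[of p'] by (simp only: objective_def)
  then have "?f (pmf p' a) a + ?f (pmf p' b) b \<le> ?f (pmf p a) a + ?f (pmf p b) b"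
    by (simp only: split rest add_le_cancel_right)
  moreover have "pmf p' a = pmf p a + t" "pmf p' b = pmf p b - t"
    using \<open>a \<noteq> b\<close> by (auto simp: p')
  ultimately show ?thesis
    by (simp add: algebra_simps)
qed

text \<open>
Were \<open>a\<close> to receive no mass, moving a small \<open>t\<close> to it from some \<open>b\<close> that
has mass would change the objective by at least \<open>t\<close> times (a constant minus
\<open>d t\<close>), which is positive for small \<open>t\<close> because \<open>d\<close> tends to
\<open>-\<infinity>\<close> at \<open>0\<close>.
\<close>

lemma max_pos: "0 < pmf p a"
proof (rule ccontr)
  assume "\<not> 0 < pmf p a"
  then have a: "pmf p a = 0"
    using pmf_nonneg[of p a] by linarith
  obtain b where b: "0 < pmf p b"
    using set_pmf_not_empty[of p] by (metis ex_in_conv pmf_positive)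
  then have "a \<noteq> b"
    using a by auto
  \<comment> \<open>Half of the mass of \<open>b\<close> is kept, so that the slope at \<open>b\<close> stays bounded below by \<open>d \<beta>\<close>.\<close>
  define \<beta> where "\<beta> = pmf p b / 2"
  have \<beta>: "0 < \<beta>" "\<beta> < 1" "pmf p b = 2 * \<beta>"
    using b pmf_le_1[of p b] unfolding \<beta>_def by auto
  define c where "c = \<eta> * (Q a - Q b) + d (pmf q a) - d (pmf q b)"
  have "\<forall>\<^sub>F t in at_right 0. d t < c + d \<beta> \<and> t \<in> {0<..<\<beta>}"
    using steep_0 \<beta> by (intro eventually_conj eventually_at_right_real) (simp_all add: filterlim_at_bot_dense)
  then obtain t where t: "d t < c + d \<beta>" "0 < t" "t < \<beta>"
    using eventually_happens[of _ "at_right (0::real)"] by (auto simp: trivial_limit_at_right_real)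
  have I: "t \<in> interior D" "2 * \<beta> - t \<in> interior D" "\<beta> \<in> interior D"
    using t \<beta> pmf_le_1[of p b] by (auto intro!: open_unit_interior)
  have "0 \<in> D" "2 * \<beta> \<in> D"
    using unit_subset_dom \<beta> pmf_le_1[of p b] by (auto simp: subset_iff)
  then have "g t - g 0 \<le> t * d t" "g (2 * \<beta> - t) - g (2 * \<beta>) \<le> - t * d (2 * \<beta> - t)"
    using tangent[OF I(1), of 0] tangent[OF I(2), of "2 * \<beta>"] by (auto simp: algebra_simps)
  moreover have "t * d \<beta> \<le> t * d (2 * \<beta> - t)"
    using t I by (intro mult_left_mono d_mono) auto
  moreover have "t * c \<le> (g t - g 0) + (g (2 * \<beta> - t) - g (2 * \<beta>))"
    using max_pairwise[OF \<open>a \<noteq> b\<close>, of t] t \<beta> a by (simp add: c_def)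
  ultimately have "t * c \<le> t * (d t - d \<beta>)"
    by (simp add: algebra_simps)
  then show False
    using t by (simp add: mult_le_cancel_left_pos)
qed

lemma max_interior: "pmf p a \<in> {0<..<1}"
proof -
  obtain b where "b \<noteq> a"
  proof -
    \<comment> \<open>The reference distribution gives \<open>a\<close> less than full mass, so there is a second action.\<close>
    have "pmf q a \<noteq> 1"
      using q[of a] by simp
    then have "(\<Sum>b\<in>UNIV. pmf q b) \<noteq> (\<Sum>b\<in>{a}. pmf q b)"
      by simp
    then have "UNIV \<noteq> {a}"
      by metis
    then show ?thesis
      using that by blast
  qed
  then have "pmf p a + pmf p b \<le> 1"
    using sum_mono2[of UNIV "{a, b}" "pmf p"] by simp
  then show ?thesis
    using max_pos[of a] max_pos[of b] by simp
qed

text \<open>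
The mirror descent step is additive in the dual coordinates \<open>d (pmf p a)\<close>, up to a constant
common to all actions; taking the difference of two actions removes that constant.
\<close>

lemma max_stationary:
  "d (pmf p a) - d (pmf p b) = d (pmf q a) - d (pmf q b) + \<eta> * (Q a - Q b)"
proof (cases "a = b")
  case False
  define c where "c = \<eta> * (Q a - Q b) + d (pmf q a) - d (pmf q b)"
  define F where "F t = g (pmf p a + t) + g (pmf p b - t) - c * t" for t
  have "(F has_real_derivative (d (pmf p a) - d (pmf p b) - c)) (at 0)"
  proof -
    have "((\<lambda>t. g (pmf p a + t)) has_real_derivative d (pmf p a) * 1) (at 0)"
      by (rule DERIV_chain2[of g])
        (auto intro!: derivative_eq_intros deriv_g open_unit_interior max_interior)
    moreover have "((\<lambda>t. g (pmf p b - t)) has_real_derivative d (pmf p b) * - 1) (at 0)"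
      by (rule DERIV_chain2[of g])
        (auto intro!: derivative_eq_intros deriv_g open_unit_interior max_interior)
    ultimately show ?thesis
      unfolding F_def by (auto intro!: derivative_eq_intros)
  qed
  moreover have "0 < min (pmf p a) (pmf p b)"
    using max_pos by simp
  moreover have "\<forall>t. \<bar>0 - t\<bar> < min (pmf p a) (pmf p b) \<longrightarrow> F 0 \<le> F t"
    using max_pairwise[OF False] by (auto simp: F_def c_def algebra_simps abs_if split: if_splits)
  ultimately have "d (pmf p a) - d (pmf p b) - c = 0"
    by (rule DERIV_local_min)
  then show ?thesis
    by (simp add: c_def)
qed simp

end

end

section \<open>Convergence of policy mirror descent\<close>

lemma linear_growth:
  fixes x :: "nat \<Rightarrow> real"
  assumes "\<And>k. T \<le> k \<Longrightarrow> x k + \<delta> \<le> x (Suc k)" and "T \<le> k"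
  shows "x T + (real k - real T) * \<delta> \<le> x k"
  using \<open>T \<le> k\<close>
proof (induction rule: dec_induct)
  case (step k)
  then show ?case
    using assms(1)[of k] by (simp add: algebra_simps)
qed simp

lemma filterlim_linear_growth:
  fixes x :: "nat \<Rightarrow> real"
  assumes "\<And>k. T \<le> k \<Longrightarrow> x k + \<delta> \<le> x (Suc k)" and "0 < \<delta>"
  shows "filterlim x at_top sequentially"
proof (rule filterlim_at_top_mono)
  have "filterlim (\<lambda>k. (x T - real T * \<delta>) + \<delta> * real k) at_top sequentially"
    using \<open>0 < \<delta>\<close>
    by (intro filterlim_tendsto_add_at_top[OF tendsto_const]
        filterlim_tendsto_pos_mult_at_top[OF tendsto_const] filterlim_real_sequentially)
  then show "filterlim (\<lambda>k. x T + (real k - real T) * \<delta>) at_top sequentially"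
    by (simp add: algebra_simps)
  show "\<forall>\<^sub>F k in sequentially. x T + (real k - real T) * \<delta> \<le> x k"
    using linear_growth[of T x \<delta>, OF assms(1)] by (auto simp: eventually_sequentially)
qed

text \<open>
\<open>\<theta>\<close> denotes the dual coordinates of the iterates. Action values are written as
\<open>backup (V k)\<close>, which is the action value function of the iterate by \<open>Q_pol_eq\<close>.
\<close>

locale pmd_run = mdp P r \<gamma> + steep_mirror_map \<psi>
  for P :: "'s::finite \<Rightarrow> 'a::finite \<Rightarrow> 's pmf" and r :: "'s \<Rightarrow> 'a \<Rightarrow> real" and \<gamma> :: real
    and \<psi> :: "real \<Rightarrow> ereal" +
  fixes \<eta> :: real and \<pi> :: "nat \<Rightarrow> 's \<Rightarrow> 'a pmf"
  assumes \<eta>_pos: "\<eta> > 0"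
    and init: "\<And>s a. pmf (\<pi> 0 s) a \<in> interior (edom \<psi>)"
    and pmd: "pmd P r \<gamma> \<psi> \<eta> \<pi>"
begin

abbreviation V :: "nat \<Rightarrow> 's \<Rightarrow> real" where "V k \<equiv> V_pol P r \<gamma> (\<pi> k)"

abbreviation \<theta> :: "nat \<Rightarrow> 's \<Rightarrow> 'a \<Rightarrow> real" where "\<theta> k s a \<equiv> d (pmf (\<pi> k s) a)"

lemma is_max:
  "is_arg_max (\<lambda>p. ereal (\<eta> * (pmf_vec p \<bullet> (\<chi> a. backup (V k) s a)))
     - bregman (separable \<psi>) (pmf_vec p) (pmf_vec (\<pi> k s))) (\<lambda>p. True) (\<pi> (Suc k) s)"
  using pmd unfolding pmd_def Q_pol_eq by blast

lemma iterate_interior: "pmf (\<pi> k s) a \<in> {0<..<1}"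
proof (induction k arbitrary: a)
  case 0
  show ?case
    using init[of s a] unit_interior_iff[of "pmf (\<pi> 0 s) a"] by (simp add: pmf_le_1)
next
  case (Suc k)
  from max_interior[OF Suc is_max] show ?case .
qed

lemma dual_step: "\<theta> (Suc k) s a - \<theta> (Suc k) s b
    = \<theta> k s a - \<theta> k s b + \<eta> * (backup (V k) s a - backup (V k) s b)"
  by (rule max_stationary[OF iterate_interior is_max])

text \<open>
The previous policy is admissible in the maximisation and has divergence zero from itself, while
divergences are nonnegative by \<open>tangent\<close>. So the new policy has at least the old average
of the current action values, which is policy improvement.
\<close>

lemma V_mono: "k \<le> l \<Longrightarrow> V k s \<le> V l s"
proof (induction rule: dec_induct)
  case (step k)
  have "V k s \<le> V (Suc k) s" for s
  proof (rule le_V_pol)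
    fix s
    let ?p = "pmf (\<pi> (Suc k) s)" and ?q = "pmf (\<pi> k s)" and ?Q = "backup (V k) s"
    have "objective \<eta> ?Q (\<pi> k s) ?q \<le> objective \<eta> ?Q (\<pi> k s) ?p"
      by (rule max_objective[OF iterate_interior is_max])
    also have "\<dots> \<le> (\<Sum>a\<in>UNIV. \<eta> * (?p a * ?Q a))"
      unfolding objective_def
    proof (rule sum_mono)
      fix a
      have "?p a \<in> D"
        using unit_subset_dom by (auto simp: subset_iff pmf_le_1)
      with tangent[OF open_unit_interior[OF iterate_interior], of _ k s a]
      show "\<eta> * (?p a * ?Q a) - g (?p a) + g (?q a) + d (?q a) * (?p a - ?q a)
          \<le> \<eta> * (?p a * ?Q a)"
        by (simp add: algebra_simps)
    qed
    finally have "\<eta> * (\<Sum>a\<in>UNIV. ?q a * ?Q a) \<le> \<eta> * (\<Sum>a\<in>UNIV. ?p a * ?Q a)"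
      by (simp add: objective_def sum_distrib_left)
    then show "V k s \<le> (\<Sum>a\<in>UNIV. ?p a * ?Q a)"
      using \<eta>_pos by (subst V_pol_backup) simp
  qed
  with step show ?case
    using order.trans by blast
qed simp

text \<open>
In the limit the step adds at least a fixed amount to the dual difference between the better and
the worse action, so it diverges.
\<close>

lemma inferior_action_tendsto_0:
  assumes v: "\<And>s. (\<lambda>k. V k s) \<longlonglongrightarrow> v s" and less: "backup v s a < backup v s b"
  shows "(\<lambda>k. pmf (\<pi> k s) a) \<longlonglongrightarrow> 0"
proof (rule tendsto_0_of_d_diff)
  define e where "e = (backup v s b - backup v s a) / 2"
  have e: "0 < e" "e < backup v s b - backup v s a"
    using less by (auto simp: e_def)
  have "(\<lambda>k. backup (V k) s b - backup (V k) s a) \<longlonglongrightarrow> backup v s b - backup v s a"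
    unfolding backup_def by (intro tendsto_intros v)
  then have "\<forall>\<^sub>F k in sequentially. e < backup (V k) s b - backup (V k) s a"
    using e(2) by (rule order_tendstoD)
  then obtain N where N: "\<And>k. N \<le> k \<Longrightarrow> e < backup (V k) s b - backup (V k) s a"
    by (auto simp: eventually_sequentially)
  show "filterlim (\<lambda>k. \<theta> k s b - \<theta> k s a) at_top sequentially"
  proof (rule filterlim_linear_growth)
    fix k assume "N \<le> k"
    from N[OF this] \<eta>_pos
    show "\<theta> k s b - \<theta> k s a + \<eta> * e \<le> \<theta> (Suc k) s b - \<theta> (Suc k) s a"
      by (simp add: dual_step)
  qed (use e \<eta>_pos in simp)
  show "pmf (\<pi> k s) b + pmf (\<pi> k s) a \<le> 1" for k
    using sum_mono2[of UNIV "{b, a}" "pmf (\<pi> k s)"] less by (cases "b = a") simp_all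
qed (rule iterate_interior)+

text \<open>
Actions whose limiting value is below the maximum lose all their mass, so the average
\<open>V k s\<close> of the action values tends to that maximum.
\<close>

lemma limit_bellman:
  assumes v: "\<And>s. (\<lambda>k. V k s) \<longlonglongrightarrow> v s"
  shows "v s = (MAX a. backup v s a)"
proof -
  have Q: "(\<lambda>k. backup (V k) s a) \<longlonglongrightarrow> backup v s a" for a
    unfolding backup_def by (intro tendsto_intros v)
  define m where "m = (MAX a. backup v s a)"
  have "m \<in> range (backup v s)"
    unfolding m_def by (rule Max_in) auto
  then obtain b where b: "m = backup v s b"
    by auto
  have "(\<lambda>k. pmf (\<pi> k s) a * (m - backup (V k) s a)) \<longlonglongrightarrow> 0" for a
  proof (cases "backup v s a = m")
    case True
    have "(\<lambda>k. m - backup (V k) s a) \<longlonglongrightarrow> 0"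
      using tendsto_diff[OF tendsto_const Q[of a], of m] True by simp
    then show ?thesis
    proof (rule Lim_null_comparison[rotated, OF tendsto_rabs_zero])
      show "\<forall>\<^sub>F k in sequentially. norm (pmf (\<pi> k s) a * (m - backup (V k) s a))
          \<le> \<bar>m - backup (V k) s a\<bar>"
        by (intro always_eventually allI) (simp add: abs_mult pmf_le_1 mult_left_le_one_le)
    qed
  next
    case False
    moreover have "backup v s a \<le> m"
      unfolding m_def by simp
    ultimately have "(\<lambda>k. pmf (\<pi> k s) a) \<longlonglongrightarrow> 0"
      using b by (intro inferior_action_tendsto_0[of v, OF v, of s a b]) simp
    from tendsto_mult[OF this tendsto_diff[OF tendsto_const Q]] show ?thesis
      by simp
  qed
  then have "(\<lambda>k. \<Sum>a\<in>UNIV. pmf (\<pi> k s) a * (m - backup (V k) s a)) \<longlonglongrightarrow> 0"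
    by (intro tendsto_null_sum)
  then have "(\<lambda>k. m - V k s) \<longlonglongrightarrow> 0"
    using V_pol_backup[of "\<pi> _" s] by (simp add: pmf_average_diff_const)
  then have "(\<lambda>k. V k s) \<longlonglongrightarrow> m"
    using tendsto_diff[OF tendsto_const[of m]] by fastforce
  then show ?thesis
    using v LIMSEQ_unique unfolding m_def by blast
qed

lemma V_tendsto_opt: "(\<lambda>k. V k s) \<longlonglongrightarrow> V_opt P r \<gamma> s"
  and V_opt_bellman: "V_opt P r \<gamma> s = (MAX a. backup (V_opt P r \<gamma>) s a)"
  and Q_opt_backup: "Q_opt P r \<gamma> = backup (V_opt P r \<gamma>)"
proof -
  have "\<exists>v. (\<lambda>k. V k s) \<longlonglongrightarrow> v" for s
  proof -
    have "incseq (\<lambda>k. V k s)"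
      by (auto simp: incseq_def intro: V_mono)
    then show ?thesis
      using incseq_convergent[of "\<lambda>k. V k s" "1 / (1 - \<gamma>)"] V_pol_le by metis
  qed
  then obtain v where v: "\<And>s. (\<lambda>k. V k s) \<longlonglongrightarrow> v s"
    by metis
  note bellman = limit_bellman[of v, OF v]
  note opt = bellman_solution_optimal[of v, OF bellman]
  show "(\<lambda>k. V k s) \<longlonglongrightarrow> V_opt P r \<gamma> s" "V_opt P r \<gamma> s = (MAX a. backup (V_opt P r \<gamma>) s a)"
    "Q_opt P r \<gamma> = backup (V_opt P r \<gamma>)"
    using v bellman by (simp_all add: opt)
qed

lemma V_le_opt: "V k s \<le> V_opt P r \<gamma> s"
  using V_mono by (intro LIMSEQ_le_const[OF V_tendsto_opt]) auto

lemma V_opt_le: "V_opt P r \<gamma> s \<le> 1 / (1 - \<gamma>)"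
  by (rule LIMSEQ_le_const2[OF V_tendsto_opt]) (auto simp: V_pol_le)

lemma Q_opt_le: "Q_opt P r \<gamma> s a \<le> V_opt P r \<gamma> s"
  by (subst V_opt_bellman) (simp add: Q_opt_backup)

lemma Q_opt_nonneg: "0 \<le> Q_opt P r \<gamma> s a"
proof -
  have "0 \<le> V_opt P r \<gamma> s" for s
    using V_pol_nonneg V_le_opt order.trans by blast
  then show ?thesis
    using reward discount by (simp add: Q_opt_backup backup_def sum_nonneg)
qed

lemma le_Q_opt: "backup (V k) s a \<le> Q_opt P r \<gamma> s a"
  unfolding Q_opt_backup by (intro backup_mono V_le_opt)

lemma optimality_gap_eq:
  "V_opt P r \<gamma> s - V k s = (\<Sum>a\<in>UNIV. pmf (\<pi> k s) a * (V_opt P r \<gamma> s - backup (V k) s a))"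
  using V_pol_backup[of "\<pi> k" s] by (simp add: pmf_average_diff_const)

lemma subopt_ge: "V_opt P r \<gamma> s - V k s \<le> subopt P r \<gamma> (\<pi> k)"
  unfolding subopt_def by (rule order.trans[OF abs_ge_self Max_ge]) auto

lemma subopt_le: "(\<And>s. V_opt P r \<gamma> s - V k s \<le> c) \<Longrightarrow> subopt P r \<gamma> (\<pi> k) \<le> c"
  unfolding subopt_def using V_le_opt[of k] by (intro Max.boundedI) auto

text \<open>
The values converge uniformly on the finite state space, so the least index in the definition of the
hitting time exists; by monotonicity the accuracy reached there persists.
\<close>

lemma V_near_opt:
  assumes "0 < \<sigma>" "hit_time P r \<gamma> \<pi> \<sigma> \<le> k"
  shows "V_opt P r \<gamma> s - V k s \<le> \<sigma>"
proof -
  have "\<forall>\<^sub>F k in sequentially. V_opt P r \<gamma> s - \<sigma> < V k s" for s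
    using \<open>0 < \<sigma>\<close> by (intro order_tendstoD[OF V_tendsto_opt]) auto
  then have "\<forall>\<^sub>F k in sequentially. \<forall>s. V_opt P r \<gamma> s - \<sigma> < V k s"
    by (rule eventually_all_finite)
  then obtain K where K: "\<And>s. V_opt P r \<gamma> s - \<sigma> < V K s"
    by (auto simp: eventually_sequentially)
  have "subopt P r \<gamma> (\<pi> K) \<le> \<sigma>"
    by (rule subopt_le) (use K in \<open>auto simp: algebra_simps less_imp_le\<close>)
  then have "subopt P r \<gamma> (\<pi> (hit_time P r \<gamma> \<pi> \<sigma>)) \<le> \<sigma>"
    unfolding hit_time_def by (rule LeastI)
  with subopt_ge[of s "hit_time P r \<gamma> \<pi> \<sigma>"] V_mono[OF assms(2), of s] show ?thesis
    by simp
qed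

lemma Q_near_opt:
  assumes "0 < \<sigma>" "hit_time P r \<gamma> \<pi> \<sigma> \<le> k"
  shows "Q_opt P r \<gamma> s a - \<sigma> \<le> backup (V k) s a"
proof -
  have "Q_opt P r \<gamma> s a - backup (V k) s a \<le> \<gamma> * \<sigma>"
    unfolding Q_opt_backup by (intro backup_diff_le V_near_opt assms)
  also have "\<dots> \<le> \<sigma>"
    using assms discount by (simp add: mult_left_le_one_le)
  finally show ?thesis
    by simp
qed

section \<open>Rates of convergence\<close>

text \<open>
The performance difference argument. One step of the policy loses at most \<open>1 / (1 - \<gamma>)\<close>
times the mass on suboptimal actions, hence \<open>c / (1 - \<gamma>)\<close> per action; accumulating
these losses over the discounted horizon gives the second factor \<open>1 / (1 - \<gamma>)\<close>.
\<close>

lemma subopt_le_suboptimal_mass: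
  assumes c: "\<And>s a. a \<notin> opt_actions P r \<gamma> s \<Longrightarrow> pmf (\<pi> k s) a \<le> c" and "0 \<le> c"
  shows "subopt P r \<gamma> (\<pi> k) \<le> real CARD('a) / (1 - \<gamma>)\<^sup>2 * c"
proof (rule subopt_le)
  fix s
  have "V_opt P r \<gamma> s - V k s \<le> real CARD('a) * (c * (1 / (1 - \<gamma>))) / (1 - \<gamma>)"
  proof (rule discounted_max_principle[OF discount(2)])
    fix s B assume B: "\<And>s'. V_opt P r \<gamma> s' - V k s' \<le> B"
    have "pmf (\<pi> k s) a * (V_opt P r \<gamma> s - Q_opt P r \<gamma> s a) \<le> c * (1 / (1 - \<gamma>))" for a
    proof (cases "a \<in> opt_actions P r \<gamma> s")
      case True
      then show ?thesis
        using \<open>0 \<le> c\<close> discount by (simp add: opt_actions_def)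
    next
      case False
      then show ?thesis
        using c[OF False] \<open>0 \<le> c\<close> V_opt_le[of s] Q_opt_nonneg[of s a] Q_opt_le[of s a]
        by (intro mult_mono) auto
    qed
    then have "(\<Sum>a\<in>UNIV. pmf (\<pi> k s) a * (V_opt P r \<gamma> s - Q_opt P r \<gamma> s a))
        \<le> real CARD('a) * (c * (1 / (1 - \<gamma>)))"
      by (intro sum_bounded_above)
    moreover have "(\<Sum>a\<in>UNIV. pmf (\<pi> k s) a * (Q_opt P r \<gamma> s a - backup (V k) s a)) \<le> \<gamma> * B"
      unfolding Q_opt_backup by (intro pmf_average_le backup_diff_le B)
    moreover have "V_opt P r \<gamma> s - V k s
        = (\<Sum>a\<in>UNIV. pmf (\<pi> k s) a * (V_opt P r \<gamma> s - Q_opt P r \<gamma> s a))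
        + (\<Sum>a\<in>UNIV. pmf (\<pi> k s) a * (Q_opt P r \<gamma> s a - backup (V k) s a))"
      unfolding optimality_gap_eq by (simp add: algebra_simps flip: sum.distrib)
    ultimately show "V_opt P r \<gamma> s - V k s \<le> real CARD('a) * (c * (1 / (1 - \<gamma>))) + \<gamma> * B"
      by linarith
  qed
  then show "V_opt P r \<gamma> s - V k s \<le> real CARD('a) / (1 - \<gamma>)\<^sup>2 * c"
    by (simp add: power2_eq_square)
qed

text \<open>
Every action contributes a nonnegative loss, so the loss of a single action already bounds the
suboptimality from below.
\<close>

lemma subopt_ge_action_mass:
  "(V_opt P r \<gamma> s - Q_opt P r \<gamma> s a) * pmf (\<pi> k s) a \<le> subopt P r \<gamma> (\<pi> k)"
proof -
  have nonneg: "0 \<le> V_opt P r \<gamma> s - backup (V k) s a" for a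
    using le_Q_opt[of k s a] Q_opt_le[of s a] by simp
  have "(V_opt P r \<gamma> s - Q_opt P r \<gamma> s a) * pmf (\<pi> k s) a
      \<le> pmf (\<pi> k s) a * (V_opt P r \<gamma> s - backup (V k) s a)"
    using le_Q_opt[of k s a] by (subst mult.commute) (intro mult_left_mono, auto)
  also have "\<dots> \<le> V_opt P r \<gamma> s - V k s"
    unfolding optimality_gap_eq
    by (rule member_le_sum[of a UNIV "\<lambda>a. pmf (\<pi> k s) a * (V_opt P r \<gamma> s - backup (V k) s a)"])
      (auto intro!: mult_nonneg_nonneg nonneg)
  also have "\<dots> \<le> subopt P r \<gamma> (\<pi> k)"
    by (rule subopt_ge)
  finally show ?thesis .
qed

lemma likely_action: "\<exists>b. 1 / real CARD('a) \<le> pmf p (b :: 'a)"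
proof (rule ccontr)
  assume "\<not> ?thesis"
  then have "(\<Sum>b\<in>UNIV. pmf p (b :: 'a)) < (\<Sum>b\<in>(UNIV :: 'a set). 1 / real CARD('a))"
    by (intro sum_strict_mono) (auto simp: not_le)
  then show False
    by simp
qed

context
  fixes \<sigma> :: real
  assumes ne: "nontrivial_states P r \<gamma> \<noteq> {}" and \<sigma>: "0 < \<sigma>" "\<sigma> < gap P r \<gamma> / 2"
begin

abbreviation T :: nat where "T \<equiv> hit_time P r \<gamma> \<pi> \<sigma>"
abbreviation \<Delta> :: real where "\<Delta> \<equiv> gap P r \<gamma>"

lemma dual_gap_bounded: "\<exists>B. \<forall>s a b. \<bar>\<theta> k s a - \<theta> k s b\<bar> \<le> B"
proof
  show "\<forall>s a b. \<bar>\<theta> k s a - \<theta> k s b\<bar> \<le> Max (range (\<lambda>(s, a, b). \<bar>\<theta> k s a - \<theta> k s b\<bar>))"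
    by (intro allI Max_ge) (auto intro!: rev_image_eqI[of "(_, _, _)"])
qed

text \<open>
After the hitting time each step adds at least \<open>\<eta> * (\<Delta> - 2 * \<sigma>)\<close> to the
dual difference between an optimal action \<open>b\<close> and a suboptimal \<open>a\<close>. Once this
difference is at least \<open>2 * x\<close>, one of the two dual coordinates accounts for half of it:
either \<open>a\<close> itself is below \<open>phi_inv \<psi> x\<close>, or \<open>b\<close> is so close to
\<open>1\<close> that at most \<open>chi_inv \<psi> x\<close> is left for \<open>a\<close>. This is where the
sum of the two inverses and the factor \<open>1/2\<close> come from.
\<close>

lemma upper_rate:
  "\<exists>C. \<forall>k\<ge>T. subopt P r \<gamma> (\<pi> k) \<le> real CARD('a) / (1 - \<gamma>)\<^sup>2 *
      (phi_inv \<psi> (1/2 * (real k * \<eta> * (\<Delta> - 2 * \<sigma>) + C)) +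
       chi_inv \<psi> (1/2 * (real k * \<eta> * (\<Delta> - 2 * \<sigma>) + C)))"
proof -
  obtain B where B: "\<And>s a b. \<bar>\<theta> T s a - \<theta> T s b\<bar> \<le> B"
    using dual_gap_bounded by blast
  \<comment> \<open>The growth starts at \<open>T\<close> from a dual difference of at least \<open>- B\<close>.\<close>
  define C where "C = - B - real T * \<eta> * (\<Delta> - 2 * \<sigma>)"
  show ?thesis
  proof (intro exI[of _ C] allI impI subopt_le_suboptimal_mass)
    fix k assume k: "T \<le> k"
    define x where "x = 1/2 * (real k * \<eta> * (\<Delta> - 2 * \<sigma>) + C)"
    have pos: "0 < phi_inv \<psi> x" "0 < chi_inv \<psi> x"
      using phi_inv_in[of x] chi_inv_in[of x] by auto
    then show "0 \<le> phi_inv \<psi> x + chi_inv \<psi> x"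
      by simp
    fix s a assume a: "a \<notin> opt_actions P r \<gamma> s"
    have "V_opt P r \<gamma> s \<in> range (Q_opt P r \<gamma> s)"
      unfolding Q_opt_backup by (subst V_opt_bellman) (rule Max_in, auto)
    then obtain b where b: "Q_opt P r \<gamma> s b = V_opt P r \<gamma> s"
      by auto
    then have "a \<noteq> b"
      using a by (auto simp: opt_actions_def)
    have "(\<theta> T s b - \<theta> T s a) + (real k - real T) * (\<eta> * (\<Delta> - 2 * \<sigma>)) \<le> \<theta> k s b - \<theta> k s a"
    proof (rule linear_growth[OF _ k, of "\<lambda>k. \<theta> k s b - \<theta> k s a"])
      fix k assume "T \<le> k"
      then have "\<Delta> - 2 * \<sigma> \<le> backup (V k) s b - backup (V k) s a"
        using gap_le[OF ne a] Q_near_opt[OF \<sigma>(1), of k s b] le_Q_opt[of k s a] \<sigma> b by simp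
      then show "\<theta> k s b - \<theta> k s a + \<eta> * (\<Delta> - 2 * \<sigma>) \<le> \<theta> (Suc k) s b - \<theta> (Suc k) s a"
        using \<eta>_pos by (simp add: dual_step)
    qed
    moreover have "- B \<le> \<theta> T s b - \<theta> T s a"
      using B[of s b a] by simp
    ultimately have "2 * x \<le> \<theta> k s b - \<theta> k s a"
      by (simp add: x_def C_def algebra_simps)
    then consider "x \<le> - \<theta> k s a" | "x \<le> \<theta> k s b"
      by linarith
    then show "pmf (\<pi> k s) a \<le> phi_inv \<psi> x + chi_inv \<psi> x"
    proof cases
      case 1
      then show ?thesis
        using le_phi_inv[OF iterate_interior[of k s a], of x] pos by simp
    next
      case 2
      have "pmf (\<pi> k s) b + pmf (\<pi> k s) a \<le> 1"
        using sum_mono2[of UNIV "{b, a}" "pmf (\<pi> k s)"] \<open>a \<noteq> b\<close> by simp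
      then show ?thesis
        using le_chi_inv[OF iterate_interior 2] pos by simp
    qed
  qed
qed

text \<open>
Take a pair \<open>s\<close>, \<open>a\<close> that attains the gap. Relative to any action the dual
coordinate of \<open>a\<close> falls by at most \<open>\<eta> * (\<Delta> + 2 * \<sigma>)\<close> per step.
The action \<open>b\<close> of mass at least \<open>1 / CARD('a)\<close> may change with \<open>k\<close>, and
may even be \<open>a\<close>, but its dual coordinate is bounded below, so that of \<open>a\<close> falls
at most linearly.
\<close>

lemma lower_rate:
  "\<exists>C. \<forall>k\<ge>T. \<Delta> * phi_inv \<psi> (real k * \<eta> * (\<Delta> + 2 * \<sigma>) + C) \<le> subopt P r \<gamma> (\<pi> k)"
proof -
  obtain B where B: "\<And>s a b. \<bar>\<theta> T s a - \<theta> T s b\<bar> \<le> B"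
    using dual_gap_bounded by blast
  obtain s a where sa: "V_opt P r \<gamma> s - Q_opt P r \<gamma> s a = \<Delta>"
    using gap_attained[OF ne] by blast
  define C where "C = B - d (1 / real CARD('a))"
  show ?thesis
  proof (intro exI[of _ C] allI impI)
    fix k assume k: "T \<le> k"
    obtain b where b: "1 / real CARD('a) \<le> pmf (\<pi> k s) b"
      using likely_action by blast
    have "(\<theta> T s a - \<theta> T s b) + (real k - real T) * - (\<eta> * (\<Delta> + 2 * \<sigma>)) \<le> \<theta> k s a - \<theta> k s b"
    proof (rule linear_growth[OF _ k, of "\<lambda>k. \<theta> k s a - \<theta> k s b"])
      fix k assume "T \<le> k"
      then have "backup (V k) s b - backup (V k) s a \<le> \<Delta> + 2 * \<sigma>"
        using Q_near_opt[OF \<sigma>(1), of k s a] le_Q_opt[of k s b] Q_opt_le[of s b] \<sigma> sa by simp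
      then have "\<eta> * (backup (V k) s b - backup (V k) s a) \<le> \<eta> * (\<Delta> + 2 * \<sigma>)"
        using \<eta>_pos by simp
      then show "\<theta> k s a - \<theta> k s b + - (\<eta> * (\<Delta> + 2 * \<sigma>)) \<le> \<theta> (Suc k) s a - \<theta> (Suc k) s b"
        unfolding dual_step by (simp add: algebra_simps)
    qed
    moreover have "- B \<le> \<theta> T s a - \<theta> T s b"
      using B[of s a b] by simp
    moreover have "d (1 / real CARD('a)) \<le> \<theta> k s b"
    proof -
      have "1 / real CARD('a) < 1"
        using b iterate_interior[of k s b] by (intro order.strict_trans1[OF b]) simp
      then show ?thesis
        using b by (intro d_mono open_unit_interior iterate_interior) auto
    qed
    moreover have "0 \<le> real T * (\<eta> * (\<Delta> + 2 * \<sigma>))"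
      using \<eta>_pos \<sigma> by simp
    ultimately have "- \<theta> k s a \<le> real k * \<eta> * (\<Delta> + 2 * \<sigma>) + C"
      by (simp add: C_def algebra_simps)
    then have "phi_inv \<psi> (real k * \<eta> * (\<Delta> + 2 * \<sigma>) + C) \<le> pmf (\<pi> k s) a"
      by (rule phi_inv_le[OF iterate_interior])
    then have "\<Delta> * phi_inv \<psi> (real k * \<eta> * (\<Delta> + 2 * \<sigma>) + C) \<le> \<Delta> * pmf (\<pi> k s) a"
      using \<sigma> by (intro mult_left_mono) auto
    also have "\<dots> \<le> subopt P r \<gamma> (\<pi> k)"
      using subopt_ge_action_mass[of s a k] unfolding sa by simp
    finally show "\<Delta> * phi_inv \<psi> (real k * \<eta> * (\<Delta> + 2 * \<sigma>) + C) \<le> subopt P r \<gamma> (\<pi> k)" .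
  qed
qed

end

end

theorem theorem3p17:
  fixes P :: "'s::finite \<Rightarrow> 'a::finite \<Rightarrow> 's pmf"
    and r :: "'s \<Rightarrow> 'a \<Rightarrow> real" and \<gamma> \<eta> \<sigma> :: real
    and \<psi> :: "real \<Rightarrow> ereal" and \<pi> :: "nat \<Rightarrow> 's \<Rightarrow> 'a pmf"
  assumes "\<forall>s a. r s a \<in> {0..1}"
    and "\<gamma> \<in> {0..<1}"
    and "nontrivial_states P r \<gamma> \<noteq> {}"
    and "mirror_map \<psi>"
    and "\<eta> > 0"
    and "\<forall>s a. pmf (\<pi> 0 s) a \<in> interior (edom \<psi>)"
    and "pmd P r \<gamma> \<psi> \<eta> \<pi>"
    and "filterlim (ederiv \<psi>) at_bot (at_right 0)"
    and "filterlim (ederiv \<psi>) at_top (at_left 1)"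
    and "\<sigma> \<in> {0<..<gap P r \<gamma> / 2}"
  shows "\<exists>C1 C2 :: real.
    (\<forall>k \<ge> hit_time P r \<gamma> \<pi> \<sigma>.
       subopt P r \<gamma> (\<pi> k) \<le> real CARD('a) / (1 - \<gamma>)\<^sup>2 *
         (phi_inv \<psi> (1/2 * (real k * \<eta> * (gap P r \<gamma> - 2 * \<sigma>) + C1)) +
          chi_inv \<psi> (1/2 * (real k * \<eta> * (gap P r \<gamma> - 2 * \<sigma>) + C1)))) \<and>
    (\<forall>k \<ge> hit_time P r \<gamma> \<pi> \<sigma>.
       subopt P r \<gamma> (\<pi> k) \<ge>
         gap P r \<gamma> * phi_inv \<psi> (real k * \<eta> * (gap P r \<gamma> + 2 * \<sigma>) + C2))"
proof -
  interpret pmd_run P r \<gamma> \<psi> \<eta> \<pi>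
    by unfold_locales (use assms in auto)
  have "0 < \<sigma>" "\<sigma> < gap P r \<gamma> / 2"
    using assms(10) by auto
  with upper_rate[OF assms(3)] lower_rate[OF assms(3)] show ?thesis
    by blast
qed

end
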